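(* Let $(f,E)$ be a smooth solution of the Vlasov-Poisson system with initial datum $f_0\in L^2(\mathrm d\mu_0)$, where $\mathrm d\mu_t=\omega(t,v)\,\mathrm dx\,\mathrm dv$ and the weight $\omega(t,v)=\sqrt{2\pi}\exp(\alpha^2(t)|v|^2/2)$ is defined with $$\alpha(t)=\alpha_0\Big(1+\gamma\,\alpha_0^2\int_0^t\max\big(1,\|E_\delta(s)\|_{L^\infty}^2\big)\,\mathrm ds\Big)^{-1/2},$$ $E_\delta$ being the approximate electric field described in the context. Let $C>0$ be a constant depending only on the mass of $f_0$ such that $\|E(t)\|_{L^\infty}^2\le C$ for all $t\ge0$, and let $\eta>0$ be small enough that $\eta\,C/\gamma<1$. Then for all $t\ge0$ $$\|f(t)\|_{L^2(\mathrm d\mu_t)}\le\|f_0\|_{L^2(\mathrm d\mu_0)}\,e^{t/4\eta}.$$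
   Context: **Vlasov-Poisson system.** $\mathbb T$ is a one-dimensional torus. The unknowns are $f=f(t,x,v)$, $E=E(t,x)$, $t\ge0$, $x\in\mathbb T$, $v\in\mathbb R$, with $$\partial_t f+v\,\partial_x f+E\,\partial_v f=0,\qquad \partial_xE=\rho-\rho_0,\qquad f(0)=f_0,\qquad \rho(t,x)=\int_{\mathbb R}f(t,x,v)\,\mathrm dv,$$ where $\rho_0$ is the constant such that $\int_{\mathbb T}\rho\,\mathrm dx=\mathrm{mes}(\mathbb T)\,\rho_0$, and $E=-\partial_x\Phi$ for a periodic potential $\Phi$ (so $E$ has zero mean). **Norm.** $\|g\|_{L^2(\mathrm d\mu_t)}^2=\iint_{\mathbb T\times\mathbb R}|g(x,v)|^2\,\omega(t,v)\,\mathrm dx\,\mathrm dv$. **Parameters and approximate field.** $\alpha_0>0$ and $\gamma>0$ are fixed parameters. $E_\delta$ is the electric field of the following discontinuous Galerkin/Hermite scheme (in which $\alpha$ is the function of the claim, coupled to $E_\delta$). Hermite basis: $H_{-1}=0$, $H_0=1$, $\sqrt n\,H_n(\xi)=\xi H_{n-1}(\xi)-\sqrt{n-1}\,H_{n-2}(\xi)$ for $n\ge1$, and $\Psi_n(t,v)=\alpha(t)H_n(\alpha(t)v)e^{-(\alpha(t)v)^2/2}/\sqrt{2\pi}$. Mesh: $\mathbb T$ is partitioned into intervals $I_j=[x_{j-1/2},x_{j+1/2}]$, $j\in\mathcal J=\{0,\dots,N_x-1\}$, with maximal length $h$; $X_h=\{u\in L^2(\mathbb T):u|_{I_j}\text{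 is a polynomial of degree}\le k,\ j\in\mathcal J\}$; $u^\pm$ denote right/left limits at an interface; $N\ge 1$ is the number of modes and $\delta=(h,1/N)$. Scheme: $f_\delta=\sum_{n=0}^{N-1}C_{\delta,n}(t,x)\Psi_n(t,v)$ with $C_{\delta,n}(t,\cdot)\in X_h$, $C_{\delta,n}=0$ for $n<0$ or $n\ge N$, and for all $0\le n\le N-1$, $j\in\mathcal J$, $\varphi_n\in X_h$, $$\frac{\mathrm d}{\mathrm dt}\int_{I_j}C_{\delta,n}\varphi_n\,\mathrm dx-\int_{I_j}g_n\,\varphi_n'\,\mathrm dx+\hat g_{n,j+1/2}\,\varphi^-_{n,j+1/2}-\hat g_{n,j-1/2}\,\varphi^+_{n,j-1/2}=\int_{I_j}\mathcal S_n[C_\delta,E_\delta]\,\varphi_n\,\mathrm dx,$$ with $g_n=\frac1\alpha(\sqrt n\,C_{\delta,n-1}+\sqrt{n+1}\,C_{\delta,n+1})$, $\hat g_n=\frac12[g_n^-+g_n^+-\frac{\nu_n}{\alpha}(C_{\delta,n}^+-C_{\delta,n}^-)]$, $\mathcal S_n[C,E]=\frac{\alpha'}{\alpha}(nC_n+\sqrt{(n-1)n}\,C_{n-2})+E\,\alpha\sqrt n\,C_{n-1}$, $\nu_n\in[\underline\nu,\overline\nu]$, $0<\underline\nu\le\overline\nu<\infty$; and $E_\delta=-\partial_x\Phi_\delta$ with $\Phi_\delta$ periodic, $\partial_xE_\delta=C_{\delta,0}-\rho_{0,\delta}$, where the constant $\rho_{0,\delta}$ satisfies $\int_{\mathbb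 T}(C_{\delta,0}-\rho_{0,\delta})\,\mathrm dx=0$. *)

theory Defs
  imports
    "HOL-Analysis.Analysis"
    "HOL-Computational_Algebra.Polynomial"
    "HOL-Probability.Essential_Supremum"
begin

text \<open>
  The torus of length \<open>L\<close> is \<open>\<real> / L\<int>\<close>: a function on it is an \<open>L\<close>-periodic function on
  \<open>\<real>\<close>, and integrals and norms over it are taken over one period \<open>{0..L}\<close>.
  Time derivatives are taken within \<open>{0..}\<close>, so they are one-sided at \<open>t = 0\<close>.
\<close>

definition periodic :: "real \<Rightarrow> (real \<Rightarrow> 'a) \<Rightarrow> bool" where
  "periodic L u \<longleftrightarrow> (\<forall>x. u (x + L) = u x)"

definition torus_measure :: "real \<Rightarrow> real measure" where
  "torus_measure L = restrict_space lborel {0..L}"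

text \<open>Extended-valued, so that an essentially unbounded function has norm \<open>\<infinity>\<close>.\<close>

definition Linf_norm :: "real \<Rightarrow> (real \<Rightarrow> real) \<Rightarrow> ennreal" where
  "Linf_norm L u = esssup (torus_measure L) (\<lambda>x. ennreal \<bar>u x\<bar>)"

definition has_periodic_potential :: "real \<Rightarrow> (real \<Rightarrow> real) \<Rightarrow> bool" where
  "has_periodic_potential L E \<longleftrightarrow>
     (\<exists>\<Phi>. periodic L \<Phi> \<and> (\<forall>x. (\<Phi> has_real_derivative - E x) (at x)))"

definition C1_on :: "'a::real_normed_vector set \<Rightarrow> ('a \<Rightarrow> real) \<Rightarrow> bool" where
  "C1_on S F \<longleftrightarrow>
     (\<exists>F' :: 'a \<Rightarrow> 'a \<Rightarrow>\<^sub>L real.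
        continuous_on S F' \<and> (\<forall>z\<in>S. (F has_derivative blinfun_apply (F' z)) (at z within S)))"

text \<open>
  Smooth solutions are read as classical solutions, of class \<open>C\<^sup>1\<close> up to \<open>t = 0\<close>; no
  decay in \<open>v\<close> is imposed beyond the integrability that makes the density meaningful.
\<close>

definition vlasov_poisson_solution ::
  "real \<Rightarrow> (real \<Rightarrow> real \<Rightarrow> real) \<Rightarrow> (real \<Rightarrow> real \<Rightarrow> real \<Rightarrow> real) \<Rightarrow> (real \<Rightarrow> real \<Rightarrow> real) \<Rightarrow> bool"
where
  "vlasov_poisson_solution L f0 f E \<longleftrightarrow>
     C1_on ({0..} \<times> UNIV \<times> UNIV) (\<lambda>(t, x, v). f t x v) \<and>
     C1_on ({0..} \<times> UNIV) (\<lambda>(t, x). E t x) \<and>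
     (\<forall>t\<ge>0. \<forall>v. periodic L (\<lambda>x. f t x v)) \<and>
     (\<forall>t\<ge>0. has_periodic_potential L (E t)) \<and>
     (\<forall>t\<ge>0. \<forall>x. integrable lborel (f t x)) \<and>
     (\<forall>t\<ge>0. \<forall>x v. \<exists>ft fx fv.
        ((\<lambda>s. f s x v) has_real_derivative ft) (at t within {0..}) \<and>
        ((\<lambda>y. f t y v) has_real_derivative fx) (at x) \<and>
        ((\<lambda>w. f t x w) has_real_derivative fv) (at v) \<and>
        ft + v * fx + E t x * fv = 0) \<and>
     (let \<rho> = (\<lambda>t x. \<integral>v. f t x v \<partial>lborel) in
        \<exists>\<rho>0. \<forall>t\<ge>0.
          integrable (torus_measure L) (\<rho> t) \<and> (\<integral>x. \<rho> t x \<partial>torus_measure L) = L * \<rho>0 \<and>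
          (\<forall>x. (E t has_real_derivative \<rho> t x - \<rho>0) (at x))) \<and>
     (\<forall>x v. f 0 x v = f0 x v)"

definition mass :: "real \<Rightarrow> (real \<Rightarrow> real \<Rightarrow> real) \<Rightarrow> real" where
  "mass L g = (\<integral>(x, v). g x v \<partial>(torus_measure L \<Otimes>\<^sub>M lborel))"

definition weight :: "(real \<Rightarrow> real) \<Rightarrow> real \<Rightarrow> real \<Rightarrow> real" where
  "weight \<alpha> t v = sqrt (2 * pi) * exp ((\<alpha> t)\<^sup>2 * \<bar>v\<bar>\<^sup>2 / 2)"

definition mu :: "real \<Rightarrow> (real \<Rightarrow> real) \<Rightarrow> real \<Rightarrow> (real \<times> real) measure" where
  "mu L \<alpha> t =
     density (torus_measure L \<Otimes>\<^sub>M lborel) (\<lambda>(x, v). ennreal (weight \<alpha> t v))"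

definition in_L2 :: "(real \<times> real) measure \<Rightarrow> (real \<Rightarrow> real \<Rightarrow> real) \<Rightarrow> bool" where
  "in_L2 M g \<longleftrightarrow>
     (\<lambda>(x, v). g x v) \<in> borel_measurable M \<and> integrable M (\<lambda>(x, v). \<bar>g x v\<bar>\<^sup>2)"

definition L2_norm :: "(real \<times> real) measure \<Rightarrow> (real \<Rightarrow> real \<Rightarrow> real) \<Rightarrow> real" where
  "L2_norm M g = sqrt (\<integral>(x, v). \<bar>g x v\<bar>\<^sup>2 \<partial>M)"

definition alpha_of :: "real \<Rightarrow> real \<Rightarrow> real \<Rightarrow> (real \<Rightarrow> real \<Rightarrow> real) \<Rightarrow> real \<Rightarrow> real" where
  "alpha_of L \<alpha>0 \<gamma> E\<delta> t =
     \<alpha>0 * (1 + \<gamma> * \<alpha>0\<^sup>2 *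
       integral {0..t} (\<lambda>s. max 1 ((enn2real (Linf_norm L (E\<delta> s)))\<^sup>2))) powr (- 1 / 2)"

text \<open>The convention \<open>H\<^sub>-\<^sub>1 = 0\<close> turns the recursion at \<open>n = 1\<close> into \<open>H\<^sub>1(\<xi>) = \<xi>\<close>.\<close>

fun hermite :: "nat \<Rightarrow> real \<Rightarrow> real" where
  "hermite 0 \<xi> = 1"
| "hermite (Suc 0) \<xi> = \<xi>"
| "hermite (Suc (Suc n)) \<xi> =
     (\<xi> * hermite (Suc n) \<xi> - sqrt (real (Suc n)) * hermite n \<xi>) / sqrt (real (Suc (Suc n)))"

definition Psi :: "(real \<Rightarrow> real) \<Rightarrow> nat \<Rightarrow> real \<Rightarrow> real \<Rightarrow> real" where
  "Psi \<alpha> n t v = \<alpha> t * hermite n (\<alpha> t * v) * exp (- (\<alpha> t * v)\<^sup>2 / 2) / sqrt (2 * pi)"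

text \<open>
  The interface \<open>x\<^bsub>j-1/2\<^esub>\<close> is \<open>xp j\<close>, so the cell \<open>I\<^sub>j\<close> is \<open>{xp j..xp (Suc j)}\<close>. The interfaces
  \<open>xp 0\<close> and \<open>xp Nx\<close> are the same point of the torus; periodicity of the functions in
  \<open>Xh\<close> makes the one-sided limits there wrap around.
\<close>

definition mesh :: "real \<Rightarrow> nat \<Rightarrow> (nat \<Rightarrow> real) \<Rightarrow> bool" where
  "mesh L Nx xp \<longleftrightarrow> 1 \<le> Nx \<and> (\<forall>j<Nx. xp j < xp (Suc j)) \<and> xp Nx = xp 0 + L"

text \<open>
  Elements of \<open>Xh\<close> are functions rather than almost-everywhere classes. Their values at the
  interfaces are arbitrary and enter the scheme nowhere.
\<close>

definition Xh :: "real \<Rightarrow> nat \<Rightarrow> (nat \<Rightarrow> real) \<Rightarrow> nat \<Rightarrow> (real \<Rightarrow> real) set" where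
  "Xh L Nx xp k =
     {u. periodic L u \<and>
         (\<forall>j<Nx. \<exists>p::real poly. degree p \<le> k \<and> (\<forall>x\<in>{xp j<..<xp (Suc j)}. u x = poly p x))}"

definition left_limit :: "(real \<Rightarrow> real) \<Rightarrow> real \<Rightarrow> real" where
  "left_limit u x = Lim (at_left x) u"

definition right_limit :: "(real \<Rightarrow> real) \<Rightarrow> real \<Rightarrow> real" where
  "right_limit u x = Lim (at_right x) u"

text \<open>
  In the next two definitions the truncated subtraction on \<open>nat\<close> is harmless: whenever
  \<open>n - 1\<close> or \<open>n - 2\<close> would be negative, the factor in front of the coefficient is \<open>0\<close>.
  Here \<open>a\<close>, \<open>a'\<close>, \<open>C\<close> and \<open>E\<close> are taken at a fixed time.
\<close>

definition dg_g :: "real \<Rightarrow> (nat \<Rightarrow> real \<Rightarrow> real) \<Rightarrow> nat \<Rightarrow> real \<Rightarrow> real" where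
  "dg_g a C n x = 1 / a * (sqrt (real n) * C (n - 1) x + sqrt (real (n + 1)) * C (n + 1) x)"

definition dg_source ::
  "real \<Rightarrow> real \<Rightarrow> (nat \<Rightarrow> real \<Rightarrow> real) \<Rightarrow> (real \<Rightarrow> real) \<Rightarrow> nat \<Rightarrow> real \<Rightarrow> real"
where
  "dg_source a a' C E n x =
     a' / a * (real n * C n x + sqrt ((real n - 1) * real n) * C (n - 2) x) +
     E x * a * sqrt (real n) * C (n - 1) x"

definition dg_flux ::
  "real \<Rightarrow> (nat \<Rightarrow> real) \<Rightarrow> (nat \<Rightarrow> real \<Rightarrow> real) \<Rightarrow> nat \<Rightarrow> real \<Rightarrow> real"
where
  "dg_flux a \<nu> C n x =
     1 / 2 * (left_limit (dg_g a C n) x + right_limit (dg_g a C n) x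
       - \<nu> n / a * (right_limit (C n) x - left_limit (C n) x))"

text \<open>
  The derivative of \<open>E\<delta> t\<close> jumps at the interfaces, so the Poisson equation is imposed inside
  the cells, together with the continuity of \<open>E\<delta> t\<close>; since \<open>C 0 t\<close> is piecewise polynomial,
  this is the equation in the sense of weak derivatives.
\<close>

definition dg_hermite_solution ::
  "real \<Rightarrow> nat \<Rightarrow> (nat \<Rightarrow> real) \<Rightarrow> nat \<Rightarrow> nat \<Rightarrow> (nat \<Rightarrow> real) \<Rightarrow> (real \<Rightarrow> real) \<Rightarrow>
   (nat \<Rightarrow> real \<Rightarrow> real \<Rightarrow> real) \<Rightarrow> (real \<Rightarrow> real \<Rightarrow> real \<Rightarrow> real) \<Rightarrow> (real \<Rightarrow> real \<Rightarrow> real) \<Rightarrow> bool"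
where
  "dg_hermite_solution L Nx xp k N \<nu> \<alpha> C f\<delta> E\<delta> \<longleftrightarrow>
     (\<forall>t\<ge>0. \<forall>x v. f\<delta> t x v = (\<Sum>n<N. C n t x * Psi \<alpha> n t v)) \<and>
     (\<forall>t\<ge>0. \<forall>n<N. C n t \<in> Xh L Nx xp k) \<and>
     (\<forall>t\<ge>0. \<forall>n\<ge>N. \<forall>x. C n t x = 0) \<and>
     (\<exists>\<alpha>'. (\<forall>t\<ge>0. (\<alpha> has_real_derivative \<alpha>' t) (at t within {0..})) \<and>
       (\<forall>n<N. \<forall>j<Nx. \<forall>\<phi>\<in>Xh L Nx xp k. \<forall>t\<ge>0. \<exists>D.
          ((\<lambda>s. integral {xp j..xp (Suc j)} (\<lambda>x. C n s x * \<phi> x)) has_real_derivative D)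
             (at t within {0..}) \<and>
          D - integral {xp j..xp (Suc j)} (\<lambda>x. dg_g (\<alpha> t) (\<lambda>m. C m t) n x * deriv \<phi> x)
            + dg_flux (\<alpha> t) \<nu> (\<lambda>m. C m t) n (xp (Suc j)) * left_limit \<phi> (xp (Suc j))
            - dg_flux (\<alpha> t) \<nu> (\<lambda>m. C m t) n (xp j) * right_limit \<phi> (xp j)
          = integral {xp j..xp (Suc j)}
              (\<lambda>x. dg_source (\<alpha> t) (\<alpha>' t) (\<lambda>m. C m t) (E\<delta> t) n x * \<phi> x))) \<and>
     (\<forall>t\<ge>0. has_periodic_potential L (E\<delta> t) \<and> continuous_on UNIV (E\<delta> t)) \<and>
     (\<exists>\<rho>0. \<forall>t\<ge>0.
        integral {0..L} (\<lambda>x. C 0 t x - \<rho>0) = 0 \<and>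
        (\<forall>j<Nx. \<forall>x\<in>{xp j<..<xp (Suc j)}. (E\<delta> t has_real_derivative C 0 t x - \<rho>0) (at x)))"

end

theory Submission
  imports Defs
begin

text \<open>
  Since \<open>f\<close> is constant along the characteristics, which preserve \<open>dx dv\<close>, only the growth of
  the weight matters, and
  \<open>(\<partial>\<^sub>t + v \<partial>\<^sub>x + E \<partial>\<^sub>v) \<omega> = (\<alpha> \<alpha>' v\<^sup>2 + E \<alpha>\<^sup>2 v) \<omega>\<close>.
  Here \<open>\<alpha>' = - (\<gamma>/2) \<alpha>\<^sup>3 m\<close> with \<open>m \<ge> 1\<close>, so Young's inequality and \<open>\<eta> C \<le> \<gamma>\<close> bound the bracket
  by \<open>1/(2\<eta>)\<close>. Instead of following characteristics, the energy identity is applied to \<open>\<omega>\<close> times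
  a compactly supported cutoff in \<open>v\<close> that decreases along characteristics, and the cutoff is
  removed by Fatou's lemma.

  The formula for \<open>\<alpha>'\<close> requires \<open>t \<mapsto> \<parallel>E\<^sub>\<delta>(t)\<parallel>\<^sub>\<infinity>\<close> to be continuous: on each cell, the scheme makes \<open>C\<^sub>\<delta>\<^sub>,\<^sub>0\<close> weakly continuous in time with values in a space of polynomials of bounded
  degree, hence strongly continuous, and \<open>E\<^sub>\<delta>\<close> inherits this in the sup norm.
\<close>

section \<open>Polynomials tested against polynomials\<close>

lemma poly_integrable_on: "poly (p::real poly) integrable_on {a..b}"
  by (intro integrable_continuous_real continuous_intros)

lemma integral_poly_add:
  "integral {a..b} (poly ((p::real poly) + q)) = integral {a..b} (poly p) + integral {a..b} (poly q)"
proof -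
  have "poly (p + q) = (\<lambda>x. poly p x + poly q x)" by auto
  then show ?thesis by (simp add: integral_add poly_integrable_on)
qed

lemma integral_poly_smult:
  "integral {a..b} (poly (smult c (p::real poly))) = c * integral {a..b} (poly p)"
proof -
  have "poly (smult c p) = (\<lambda>x. c * poly p x)" by auto
  then show ?thesis by simp
qed

lemma integral_poly_diff:
  "integral {a..b} (poly ((p::real poly) - q)) = integral {a..b} (poly p) - integral {a..b} (poly q)"
  using integral_poly_add[of a b "p - q" q] by simp

text \<open>The pairing by integration is definite: a nonnegative continuous integrand with zero
  integral vanishes on the whole interval, while a nonzero polynomial has only finitely many
  roots.\<close>

lemma integral_poly_square_eq_0:
  assumes "a < b" "integral {a..b} (poly ((p::real poly) * p)) = 0"
  shows "p = 0"
proof (rule ccontr)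
  assume "p \<noteq> 0"
  then have "finite {x. poly p x = 0}" by (rule poly_roots_finite)
  moreover have "infinite {a..b}" using assms by simp
  ultimately obtain x where x: "x \<in> {a..b}" "poly p x \<noteq> 0"
    by (metis (mono_tags, lifting) finite_subset mem_Collect_eq subsetI)
  have "poly (p * p) x = 0"
    using integral_eq_0_iff[of a b "poly (p * p)"] assms x continuous_on_poly[OF continuous_on_id]
    by fastforce
  with x show False by simp
qed

text \<open>Gram-Schmidt by induction on the dimension \<open>n\<close>: the induction hypothesis
  for \<open>monom 1 n\<close> yields a monic \<open>Q\<close> orthogonal to all lower degrees, and
  the component along \<open>Q\<close> is added to the lower projection. Vanishing coefficients from
  \<open>n\<close> on, instead of a degree bound, make \<open>n = 0\<close> the zero space.\<close>

lemma orthogonal_projection_poly: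
  fixes p :: "real poly"
  assumes "a < b"
  shows "\<exists>r. (\<forall>i\<ge>n. coeff r i = 0) \<and>
    (\<forall>q. (\<forall>i\<ge>n. coeff q i = 0) \<longrightarrow> integral {a..b} (poly ((p - r) * q)) = 0)"
proof (induction n arbitrary: p)
  case 0
  have "integral {a..b} (poly (p * q)) = 0" if "\<forall>i. coeff q i = 0" for q
  proof -
    have "q = 0" using that by (simp add: poly_eq_iff)
    then show ?thesis using integral_poly_smult[of a b 0 p] by simp
  qed
  then show ?case by (intro exI[of _ 0]) (simp del: poly_mult)
next
  case (Suc n)
  obtain s where s: "\<forall>i\<ge>n. coeff s i = 0"
    "\<And>q. \<forall>i\<ge>n. coeff q i = 0 \<Longrightarrow> integral {a..b} (poly ((monom 1 n - s) * q)) = 0"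
    using Suc[of "monom 1 n"] by blast
  define Q where "Q = monom 1 n - s"
  have Q: "coeff Q n = 1" "\<And>i. i > n \<Longrightarrow> coeff Q i = 0" using s(1) by (auto simp: Q_def)
  then have "Q \<noteq> 0" by auto
  then have Q2: "integral {a..b} (poly (Q * Q)) \<noteq> 0"
    using integral_poly_square_eq_0[OF assms] by blast
  obtain r where r: "\<forall>i\<ge>n. coeff r i = 0"
    "\<And>q. \<forall>i\<ge>n. coeff q i = 0 \<Longrightarrow> integral {a..b} (poly ((p - r) * q)) = 0"
    using Suc[of p] by blast
  define c where "c = integral {a..b} (poly ((p - r) * Q)) / integral {a..b} (poly (Q * Q))"
  have *: "integral {a..b} (poly ((p - (r + smult c Q)) * q)) =
      integral {a..b} (poly ((p - r) * q)) - c * integral {a..b} (poly (Q * q))" for q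
    by (simp add: algebra_simps flip: integral_poly_diff integral_poly_smult)
  show ?case
  proof (intro exI[of _ "r + smult c Q"] conjI allI impI)
    fix i assume "Suc n \<le> i" then show "coeff (r + smult c Q) i = 0" using r Q by simp
  next
    fix q :: "real poly" assume q: "\<forall>i\<ge>Suc n. coeff q i = 0"
    \<comment> \<open>As \<open>Q\<close> is monic of degree \<open>n\<close>, this removes the top
      coefficient of \<open>q\<close>; the residual is then tested against \<open>q'\<close> and
      \<open>Q\<close> separately.\<close>
    define q' where "q' = q - smult (coeff q n) Q"
    have "\<forall>i\<ge>n. coeff q' i = 0"
    proof safe
      fix i assume "n \<le> i" then show "coeff q' i = 0"
        using q Q by (cases "i = n") (auto simp: q'_def)
    qed
    then have "integral {a..b} (poly ((p - (r + smult c Q)) * q')) = 0"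
      unfolding * using r(2) s(2) by (simp add: Q_def)
    moreover have "integral {a..b} (poly ((p - (r + smult c Q)) * Q)) = 0"
      unfolding * using Q2 by (simp add: c_def)
    moreover have "(p - (r + smult c Q)) * q =
        (p - (r + smult c Q)) * q' + smult (coeff q n) ((p - (r + smult c Q)) * Q)"
      by (simp add: q'_def right_diff_distrib)
    ultimately show "integral {a..b} (poly ((p - (r + smult c Q)) * q)) = 0"
      by (simp add: integral_poly_add integral_poly_smult)
  qed
qed

text \<open>In a finite-dimensional space of polynomials, convergence against every test element
  forces uniform convergence. The induction peels off one dimension at a time: the top coefficient
  tends to 0, and the remainder satisfies the same hypotheses one degree lower. The degree condition
  is only eventual because it will be known for nonnegative times only.\<close>

lemma poly_uniform_tendsto_0:
  fixes p :: "'t \<Rightarrow> real poly"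
  assumes "a < b"
    and "\<forall>\<^sub>F t in F. \<forall>i\<ge>n. coeff (p t) i = 0"
    and "\<And>q. \<forall>i\<ge>n. coeff q i = 0 \<Longrightarrow> ((\<lambda>t. integral {a..b} (poly (p t * q))) \<longlongrightarrow> 0) F"
    and "\<epsilon> > 0"
  shows "\<forall>\<^sub>F t in F. \<forall>x\<in>{a..b}. \<bar>poly (p t) x\<bar> < \<epsilon>"
  using assms(2-4)
proof (induction n arbitrary: p \<epsilon>)
  case 0
  from 0(1) show ?case
  proof eventually_elim
    case (elim t)
    then have "p t = 0" by (simp add: poly_eq_iff)
    then show ?case using 0 by simp
  qed
next
  case (Suc n)
  obtain s where s: "\<forall>i\<ge>n. coeff s i = 0"
    "\<And>q. \<forall>i\<ge>n. coeff q i = 0 \<Longrightarrow> integral {a..b} (poly ((monom 1 n - s) * q)) = 0"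
    using orthogonal_projection_poly[OF \<open>a < b\<close>, of n "monom 1 n"] by blast
  define Q where "Q = monom 1 n - s"
  have Q: "coeff Q n = 1" "\<And>i. i > n \<Longrightarrow> coeff Q i = 0" using s(1) by (auto simp: Q_def)
  then have "Q \<noteq> 0" by auto
  then have Q2: "integral {a..b} (poly (Q * Q)) \<noteq> 0"
    using integral_poly_square_eq_0[OF \<open>a < b\<close>] by blast
  have QP: "integral {a..b} (poly (Q * q)) = 0" if "\<forall>i\<ge>n. coeff q i = 0" for q
    using s(2)[OF that] by (simp add: Q_def)
  \<comment> \<open>\<open>Q\<close> is orthogonal to all lower degrees, so testing with \<open>Q\<close> isolates the top coefficient.\<close>
  define c where "c t = coeff (p t) n" for t
  define p' where "p' t = p t - smult (c t) Q" for t
  have p': "\<forall>\<^sub>F t in F. \<forall>i\<ge>n. coeff (p' t) i = 0"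
    using Suc.prems(1)
  proof eventually_elim
    case (elim t)
    show ?case
    proof safe
      fix i assume "n \<le> i" then show "coeff (p' t) i = 0"
        using elim Q by (cases "i = n") (auto simp: p'_def c_def)
    qed
  qed
  have split: "p t = p' t + smult (c t) Q" for t by (simp add: p'_def)
  have *: "integral {a..b} (poly (p t * q)) =
      integral {a..b} (poly (p' t * q)) + c t * integral {a..b} (poly (Q * q))" for t q
    by (simp add: split[of t] algebra_simps flip: integral_poly_add integral_poly_smult)
  have "((\<lambda>t. integral {a..b} (poly (p t * Q)) / integral {a..b} (poly (Q * Q))) \<longlongrightarrow> 0) F"
    using tendsto_divide[OF Suc.prems(2)[of Q] tendsto_const Q2] Q by (simp del: poly_mult)
  then have c0: "(c \<longlongrightarrow> 0) F"
  proof (rule Lim_transform_eventually)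
    show "\<forall>\<^sub>F t in F. integral {a..b} (poly (p t * Q)) / integral {a..b} (poly (Q * Q)) = c t"
      using p'
    proof eventually_elim
      case (elim t)
      then show ?case using QP[of "p' t"] Q2 unfolding * by (simp add: mult.commute)
    qed
  qed
  have "((\<lambda>t. integral {a..b} (poly (p' t * q))) \<longlongrightarrow> 0) F" if q: "\<forall>i\<ge>n. coeff q i = 0" for q
    using Suc.prems(2)[of q] q QP[OF q] by (simp add: * del: poly_mult)
  then have 1: "\<forall>\<^sub>F t in F. \<forall>x\<in>{a..b}. \<bar>poly (p' t) x\<bar> < \<epsilon> / 2"
    using Suc.IH[OF p', of "\<epsilon> / 2"] Suc.prems(3) by (simp del: poly_mult)
  have "compact (poly Q ` {a..b})" by (intro compact_continuous_image continuous_intros) auto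
  then obtain B where B: "B > 0" "\<And>x. x \<in> {a..b} \<Longrightarrow> \<bar>poly Q x\<bar> \<le> B"
    using compact_imp_bounded bounded_pos[of "poly Q ` {a..b}"] by (metis imageI real_norm_def)
  have 2: "\<forall>\<^sub>F t in F. \<bar>c t\<bar> < \<epsilon> / 2 / B"
    using c0 Suc.prems B tendstoD[of c 0 F "\<epsilon> / 2 / B"] by (simp add: dist_real_def)
  from 1 2 show ?case
  proof eventually_elim
    case (elim t)
    show ?case
    proof
      fix x assume x: "x \<in> {a..b}"
      have "\<bar>c t * poly Q x\<bar> \<le> \<epsilon> / 2 / B * B"
        unfolding abs_mult using elim(2) B(2)[OF x] B(1) by (intro mult_mono) auto
      also have "\<dots> = \<epsilon> / 2" using B by simp
      finally show "\<bar>poly (p t) x\<bar> < \<epsilon>" using elim(1) x split[of t] by force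
    qed
  qed
qed

section \<open>Continuity of the approximate field\<close>

lemma Linf_norm_bounded:
  assumes "continuous_on UNIV u"
  obtains B where "B \<ge> 0" "Linf_norm L u \<le> ennreal B"
proof -
  have "compact (u ` {0..L})"
    using assms by (intro compact_continuous_image) (auto intro: continuous_on_subset)
  then obtain B where B: "B > 0" "\<And>x. x \<in> {0..L} \<Longrightarrow> \<bar>u x\<bar> \<le> B"
    using compact_imp_bounded bounded_pos[of "u ` {0..L}"] by (metis imageI real_norm_def)
  have [measurable]: "u \<in> borel_measurable borel"
    using assms by (rule borel_measurable_continuous_onI)
  have "Linf_norm L u \<le> ennreal B" unfolding Linf_norm_def torus_measure_def
    by (rule esssup_I) (auto intro!: measurable_restrict_space1 AE_I2 ennreal_leI B simp: space_restrict_space)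
  with B that[of B] show ?thesis by simp
qed

lemma Linf_norm_close:
  assumes u: "continuous_on UNIV u" and w: "continuous_on UNIV w"
    and le: "\<And>x. \<bar>u x - w x\<bar> \<le> e"
  shows "\<bar>enn2real (Linf_norm L u) - enn2real (Linf_norm L w)\<bar> \<le> e"
proof -
  have e: "e \<ge> 0" using le[of 0] by simp
  have *: "enn2real (Linf_norm L u) \<le> enn2real (Linf_norm L w) + e"
    if u': "continuous_on UNIV u" and w': "continuous_on UNIV w"
      and le: "\<And>x. \<bar>u x - w x\<bar> \<le> e" for u w
  proof -
    have [measurable]: "u \<in> borel_measurable borel" "w \<in> borel_measurable borel"
      using u' w' by (auto intro: borel_measurable_continuous_onI)
    have "AE x in torus_measure L. ennreal \<bar>w x\<bar> \<le> Linf_norm L w"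
      unfolding Linf_norm_def by (rule esssup_AE)
    then have "AE x in torus_measure L. ennreal \<bar>u x\<bar> \<le> Linf_norm L w + ennreal e"
    proof eventually_elim
      case (elim x)
      have "ennreal \<bar>u x\<bar> \<le> ennreal (\<bar>w x\<bar> + e)" using le[of x] by (intro ennreal_leI) auto
      also have "\<dots> = ennreal \<bar>w x\<bar> + ennreal e" using e by simp
      finally show ?case using elim by (meson add_right_mono order_trans)
    qed
    then have le': "Linf_norm L u \<le> Linf_norm L w + ennreal e"
      unfolding Linf_norm_def[of L u]
      by (intro esssup_I) (auto simp: torus_measure_def intro!: measurable_restrict_space1)
    \<comment> \<open>\<open>enn2real\<close> sends \<open>top\<close> to 0, so passing to real
      values requires finite norms; continuity on the compact period supplies them.\<close>
    obtain B where B: "B \<ge> 0" "Linf_norm L w \<le> ennreal B" using Linf_norm_bounded[OF w'] .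
    then have fin: "Linf_norm L w < top" by (simp add: le_less_trans)
    have "enn2real (Linf_norm L u) \<le> enn2real (Linf_norm L w + ennreal e)"
      by (rule enn2real_mono[OF le']) (use fin in \<open>simp add: ennreal_add_eq_top less_top\<close>)
    also have "\<dots> = enn2real (Linf_norm L w) + e"
      using fin e by (simp add: enn2real_plus)
    finally show ?thesis .
  qed
  show ?thesis using *[OF u w le] *[OF w u] le by (simp add: abs_minus_commute abs_diff_le_iff)
qed

section \<open>Periodic fields with a periodic potential\<close>

lemma periodic_int:
  assumes "periodic L u" shows "u (x + of_int m * L) = u x"
proof (induction m rule: int_induct[where k = 0])
  case (step1 i)
  have "u (x + of_int i * L + L) = u (x + of_int i * L)"
    using assms unfolding periodic_def by blast
  then show ?case using step1 by (simp add: algebra_simps)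
next
  case (step2 i)
  have "u (x + of_int (i - 1) * L + L) = u (x + of_int (i - 1) * L)"
    using assms unfolding periodic_def by blast
  then show ?case using step2 by (simp add: algebra_simps)
qed simp

lemma has_periodic_potential_diff:
  assumes "has_periodic_potential L u" "has_periodic_potential L w"
  shows "has_periodic_potential L (\<lambda>x. u x - w x)"
proof -
  obtain \<Phi> \<Psi> where "periodic L \<Phi>" "\<And>x. (\<Phi> has_real_derivative - u x) (at x)"
    "periodic L \<Psi>" "\<And>x. (\<Psi> has_real_derivative - w x) (at x)"
    using assms unfolding has_periodic_potential_def by auto
  then show ?thesis unfolding has_periodic_potential_def
    by (intro exI[of _ "\<lambda>x. \<Phi> x - \<Psi> x"]) (auto simp: periodic_def intro!: derivative_eq_intros)
qed

lemma has_periodic_potential_imp_periodic: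
  assumes "has_periodic_potential L u"
  shows "periodic L u"
proof -
  obtain \<Phi> where \<Phi>: "periodic L \<Phi>" "\<And>x. (\<Phi> has_real_derivative - u x) (at x)"
    using assms unfolding has_periodic_potential_def by auto
  have "u (x + L) = u x" for x
  proof -
    have "((\<lambda>x. \<Phi> (x + L)) has_real_derivative - u (x + L)) (at x)"
      using \<Phi>(2)[of "x + L"] by (simp add: DERIV_shift)
    moreover have "(\<lambda>x. \<Phi> (x + L)) = \<Phi>" using \<Phi>(1) by (auto simp: periodic_def)
    ultimately show ?thesis using \<Phi>(2)[of x] DERIV_unique by fastforce
  qed
  then show ?thesis by (simp add: periodic_def)
qed

text \<open>The form in which zero mean is used: the mean value theorem for the potential over one
  period yields a zero of the field there.\<close>

lemma has_periodic_potential_zero: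
  assumes "has_periodic_potential L u" "0 < L"
  obtains z where "a < z" "z < a + L" "u z = 0"
proof -
  obtain \<Phi> where \<Phi>: "periodic L \<Phi>" "\<And>x. (\<Phi> has_real_derivative - u x) (at x)"
    using assms unfolding has_periodic_potential_def by auto
  obtain z where "a < z" "z < a + L" "\<Phi> (a + L) - \<Phi> a = (a + L - a) * (- u z)"
    using MVT2[of a "a + L" \<Phi> "\<lambda>x. - u x"] \<Phi>(2) assms(2) by auto
  then show ?thesis using that \<Phi>(1) assms(2) by (simp add: periodic_def)
qed

text \<open>The approximate field may have corners at the interfaces, where the mean value theorem
  breaks down; the fundamental theorem of calculus tolerates a finite exceptional set.\<close>

lemma Lipschitz_off_finite:
  fixes u :: "real \<Rightarrow> real"
  assumes "finite S" "continuous_on {a..b} u" "0 \<le> M" "a \<le> b"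
    and deriv: "\<And>x. x \<in> {a..b} - S \<Longrightarrow> (u has_real_derivative c x) (at x)"
    and bound: "\<And>x. x \<in> {a..b} - S \<Longrightarrow> \<bar>c x\<bar> \<le> M"
  shows "\<bar>u b - u a\<bar> \<le> M * (b - a)"
proof -
  have "(c has_integral (u b - u a)) {a..b}"
    using assms by (intro fundamental_theorem_of_calculus_strong[of S])
      (auto simp flip: has_real_derivative_iff_has_vector_derivative)
  then show ?thesis
    using has_integral_bound_real[of M S c _ a b] assms(1,3,4) bound by simp
qed

lemma cell_cases:
  fixes xp :: "nat \<Rightarrow> real"
  assumes "x \<in> {xp 0..xp n}" "x \<notin> xp ` {..n}"
  obtains j where "j < n" "x \<in> {xp j<..<xp (Suc j)}"
  using assms
proof (induction n arbitrary: thesis)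
  case 0 then show ?case by auto
next
  case (Suc n)
  show ?case
  proof (cases "x \<le> xp n")
    case True
    then obtain j where "j < n" "x \<in> {xp j<..<xp (Suc j)}"
      using Suc.IH[of thesis] Suc.prems by (auto simp: atMost_Suc)
    then show ?thesis using Suc.prems(1)[of j] by simp
  next
    case False
    have "x \<noteq> xp (Suc n)" using Suc.prems(3) by auto
    then show ?thesis using False Suc.prems(1)[of n] Suc.prems(2) by auto
  qed
qed

lemma mesh_mono:
  assumes "mesh L Nx xp" "i \<le> j" "j \<le> Nx"
  shows "xp i \<le> xp j"
  using assms(2,3)
proof (induction j rule: dec_induct)
  case (step n)
  then have "xp n < xp (Suc n)" using assms(1) by (simp add: mesh_def)
  with step show ?case by simp
qed simp

text \<open>A Poincare inequality in the sup norm: the field has a zero in the period and slope at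
  most \<open>M\<close>, so it cannot exceed \<open>M * L\<close>. Applied to a difference of
  fields, it converts closeness of densities into closeness of fields.\<close>

lemma periodic_potential_bound:
  assumes "has_periodic_potential L u" "continuous_on UNIV u" "0 < L" "mesh L Nx xp" "0 \<le> M"
    and deriv: "\<And>j x. j < Nx \<Longrightarrow> x \<in> {xp j<..<xp (Suc j)} \<Longrightarrow> (u has_real_derivative c x) (at x)"
    and bound: "\<And>j x. j < Nx \<Longrightarrow> x \<in> {xp j<..<xp (Suc j)} \<Longrightarrow> \<bar>c x\<bar> \<le> M"
  shows "\<bar>u x\<bar> \<le> M * L"
proof -
  obtain z where z: "xp 0 < z" "z < xp 0 + L" "u z = 0"
    using has_periodic_potential_zero[OF assms(1,3)] .
  have xpN: "xp Nx = xp 0 + L" using assms(4) by (simp add: mesh_def)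
  define S where "S = xp ` {..Nx}"
  have S: "finite S" by (simp add: S_def)
  have Lip: "\<bar>u r - u l\<bar> \<le> M * (r - l)" if "xp 0 \<le> l" "l \<le> r" "r \<le> xp 0 + L" for l r
  proof (rule Lipschitz_off_finite[OF S _ assms(5) that(2), of _ c])
    fix y assume y: "y \<in> {l..r} - S"
    then have "y \<in> {xp 0..xp Nx}" "y \<notin> xp ` {..Nx}" using that xpN by (auto simp: S_def)
    then obtain j where "j < Nx" "y \<in> {xp j<..<xp (Suc j)}" by (rule cell_cases)
    then show "(u has_real_derivative c y) (at y)" "\<bar>c y\<bar> \<le> M" using deriv bound by blast+
  qed (use assms(2) in \<open>auto intro: continuous_on_subset\<close>)
  \<comment> \<open>Translation by \<open>m\<close> periods moves \<open>x\<close> into the period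
    that starts at \<open>xp 0\<close>, where the mesh lives.\<close>
  define m where "m = \<lfloor>(x - xp 0) / L\<rfloor>"
  define y where "y = x - of_int m * L"
  have "of_int m \<le> (x - xp 0) / L" "(x - xp 0) / L < of_int m + 1"
    unfolding m_def by linarith+
  then have y: "xp 0 \<le> y" "y \<le> xp 0 + L"
    using \<open>0 < L\<close> by (auto simp: y_def field_simps)
  have "u x = u y"
    using periodic_int[OF has_periodic_potential_imp_periodic[OF assms(1)], of y m] by (simp add: y_def)
  moreover have "\<bar>u y\<bar> \<le> M * \<bar>y - z\<bar>"
    using Lip[of y z] Lip[of z y] z y by (cases "y \<le> z") auto
  moreover have "M * \<bar>y - z\<bar> \<le> M * L" using y z assms(5) by (intro mult_left_mono) auto
  ultimately show ?thesis by linarith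
qed

section \<open>Continuity in time of the coefficients and the field\<close>

text \<open>Elements of \<open>Xh\<close> are periodic, so a polynomial becomes a test function by
  repeating its values on the period from \<open>xp 0\<close>. It is not cut off to one cell, since
  the scheme is tested cell by cell.\<close>

lemma poly_periodic_in_Xh:
  assumes "0 < L" "mesh L Nx xp" "degree q \<le> k"
  defines "\<phi> \<equiv> \<lambda>x. poly q (x - of_int \<lfloor>(x - xp 0) / L\<rfloor> * L)"
  shows "\<phi> \<in> Xh L Nx xp k"
    and "\<And>j x. j < Nx \<Longrightarrow> x \<in> {xp j<..<xp (Suc j)} \<Longrightarrow> \<phi> x = poly q x"
proof -
  show *: "\<phi> x = poly q x" if "j < Nx" "x \<in> {xp j<..<xp (Suc j)}" for j x
  proof -
    have "xp 0 \<le> xp j" "xp (Suc j) \<le> xp Nx"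
      using that mesh_mono[OF assms(2), of 0 j] mesh_mono[OF assms(2), of "Suc j" Nx] by auto
    then have "\<lfloor>(x - xp 0) / L\<rfloor> = 0"
      using that assms(1,2) by (auto simp: floor_eq_iff mesh_def)
    then show ?thesis by (simp add: \<phi>_def)
  qed
  have "\<phi> (x + L) = \<phi> x" for x
  proof -
    have "(x + L - xp 0) / L = (x - xp 0) / L + 1" using assms(1) by (simp add: field_simps)
    then have "\<lfloor>(x + L - xp 0) / L\<rfloor> = \<lfloor>(x - xp 0) / L\<rfloor> + 1" by simp
    then show ?thesis by (simp add: \<phi>_def algebra_simps)
  qed
  then show "\<phi> \<in> Xh L Nx xp k" unfolding Xh_def periodic_def using assms(3) * by blast
qed

lemma dg_coefficient_continuous:
  assumes "0 < L" "mesh L Nx xp" and sol: "dg_hermite_solution L Nx xp k N \<nu> \<alpha> C f\<delta> E"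
    and "n < N" "j < Nx" "0 \<le> s" "\<epsilon> > 0"
  shows "\<forall>\<^sub>F t in at s within {0..}. \<forall>x\<in>{xp j<..<xp (Suc j)}. \<bar>C n t x - C n s x\<bar> < \<epsilon>"
proof -
  let ?a = "xp j" and ?b = "xp (Suc j)"
  have ab: "?a < ?b" using assms by (simp add: mesh_def)
  have "\<forall>t\<in>{0..}. \<exists>p::real poly. degree p \<le> k \<and> (\<forall>x\<in>{?a<..<?b}. C n t x = poly p x)"
    using sol assms(4,5) unfolding dg_hermite_solution_def Xh_def by fastforce
  then obtain p :: "real \<Rightarrow> real poly" where
    p: "\<And>t. t \<ge> 0 \<Longrightarrow> degree (p t) \<le> k" "\<And>t x. t \<ge> 0 \<Longrightarrow> x \<in> {?a<..<?b} \<Longrightarrow> C n t x = poly (p t) x"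
    by (metis atLeast_iff)
  have ge0: "\<forall>\<^sub>F t in at s within {0..}. 0 \<le> t" by (simp add: eventually_at_filter)
  have "\<forall>\<^sub>F t in at s within {0..}. \<forall>x\<in>{?a..?b}. \<bar>poly (p t - p s) x\<bar> < \<epsilon>"
  \<comment> \<open>Degree at most \<open>k\<close> means vanishing coefficients from index
    \<open>Suc k\<close> on.\<close>
  proof (rule poly_uniform_tendsto_0[OF ab, of "Suc k"])
    show "\<forall>\<^sub>F t in at s within {0..}. \<forall>i\<ge>Suc k. coeff (p t - p s) i = 0"
      using ge0
    proof eventually_elim
      case (elim t)
      then show ?case using p(1)[of t] p(1)[of s] \<open>0 \<le> s\<close> by (auto simp: coeff_eq_0)
    qed
  next
    fix q :: "real poly" assume "\<forall>i\<ge>Suc k. coeff q i = 0"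
    then have q: "degree q \<le> k" by (intro degree_le) auto
    define \<phi> where "\<phi> x = poly q (x - of_int \<lfloor>(x - xp 0) / L\<rfloor> * L)" for x
    have \<phi>: "\<phi> \<in> Xh L Nx xp k" "\<And>x. x \<in> {?a<..<?b} \<Longrightarrow> \<phi> x = poly q x"
      using poly_periodic_in_Xh[OF assms(1,2) q] assms(5) unfolding \<phi>_def by blast+
    \<comment> \<open>Interface values of functions in \<open>Xh\<close> are arbitrary, so the
      integrands are only known to agree off the two endpoints, a null set.\<close>
    have eq: "integral {?a..?b} (\<lambda>x. C n t x * \<phi> x) = integral {?a..?b} (poly (p t * q))"
      if "t \<ge> 0" for t
      by (rule integral_spike[of "{?a, ?b}"]) (auto simp: p(2)[OF that] \<phi>(2))
    obtain D where "((\<lambda>t. integral {?a..?b} (\<lambda>x. C n t x * \<phi> x)) has_real_derivative D) (at s within {0..})"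
      using sol assms(4-6) \<phi>(1) unfolding dg_hermite_solution_def by meson
    then have "((\<lambda>t. integral {?a..?b} (\<lambda>x. C n t x * \<phi> x)) \<longlongrightarrow> integral {?a..?b} (\<lambda>x. C n s x * \<phi> x))
        (at s within {0..})"
      using DERIV_continuous continuous_within by blast
    then have "((\<lambda>t. integral {?a..?b} (poly (p t * q))) \<longlongrightarrow> integral {?a..?b} (poly (p s * q)))
        (at s within {0..})"
      unfolding eq[OF \<open>0 \<le> s\<close>]
      by (rule Lim_transform_eventually) (use ge0 in eventually_elim, simp add: eq)
    then show "((\<lambda>t. integral {?a..?b} (poly ((p t - p s) * q))) \<longlongrightarrow> 0) (at s within {0..})"
      by (simp add: left_diff_distrib integral_poly_diff LIM_zero)
  qed (use assms in auto)
  then show ?thesis using ge0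
  proof eventually_elim
    case (elim t)
    then show ?case using p(2)[of t] p(2)[of s] \<open>0 \<le> s\<close> by force
  qed
qed

lemma dg_hermite_solution_field:
  assumes "dg_hermite_solution L Nx xp k N \<nu> \<alpha> C f\<delta> E"
  shows "\<forall>t\<ge>0. has_periodic_potential L (E t) \<and> continuous_on UNIV (E t)"
    and "\<exists>\<rho>0. \<forall>t\<ge>0. integral {0..L} (\<lambda>x. C 0 t x - \<rho>0) = 0 \<and>
      (\<forall>j<Nx. \<forall>x\<in>{xp j<..<xp (Suc j)}. (E t has_real_derivative C 0 t x - \<rho>0) (at x))"
  using assms unfolding dg_hermite_solution_def by - (elim conjE, assumption)+

lemma dg_field_continuous:
  assumes "0 < L" "mesh L Nx xp" "1 \<le> N" and sol: "dg_hermite_solution L Nx xp k N \<nu> \<alpha> C f\<delta> E"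
    and "0 \<le> s" "\<epsilon> > 0"
  shows "\<forall>\<^sub>F t in at s within {0..}. \<forall>x. \<bar>E t x - E s x\<bar> \<le> \<epsilon>"
proof -
  have ge0: "\<forall>\<^sub>F t in at s within {0..}. 0 \<le> t" by (simp add: eventually_at_filter)
  \<comment> \<open>The tolerance is divided by \<open>L\<close> to offset the factor in
    \<open>periodic_potential_bound\<close>. Finitely many cells allow a common time
    neighbourhood.\<close>
  have "\<forall>\<^sub>F t in at s within {0..}. \<forall>j\<in>{..<Nx}. \<forall>x\<in>{xp j<..<xp (Suc j)}. \<bar>C 0 t x - C 0 s x\<bar> < \<epsilon> / L"
  proof (rule eventually_ball_finite[OF finite_lessThan], rule ballI)
    fix j assume "j \<in> {..<Nx}"
    then show "\<forall>\<^sub>F t in at s within {0..}. \<forall>x\<in>{xp j<..<xp (Suc j)}. \<bar>C 0 t x - C 0 s x\<bar> < \<epsilon> / L"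
      using assms(1,3,5,6) by (intro dg_coefficient_continuous[OF assms(1,2) sol]) auto
  qed
  then show ?thesis using ge0
  proof eventually_elim
    case (elim t)
    have E: "\<forall>t\<ge>0. has_periodic_potential L (E t) \<and> continuous_on UNIV (E t)"
      using dg_hermite_solution_field[OF sol] by blast
    obtain \<rho>0 where
      \<rho>0: "\<forall>t\<ge>0. \<forall>j<Nx. \<forall>x\<in>{xp j<..<xp (Suc j)}. (E t has_real_derivative C 0 t x - \<rho>0) (at x)"
      using dg_hermite_solution_field[OF sol] by blast
    have "\<bar>E t x - E s x\<bar> \<le> \<epsilon> / L * L" for x
    proof (rule periodic_potential_bound[where c = "\<lambda>x. C 0 t x - C 0 s x" and u = "\<lambda>x. E t x - E s x"])
      fix j x assume jx: "j < Nx" "x \<in> {xp j<..<xp (Suc j)}"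
      \<comment> \<open>One background density serves all times, so it cancels in the
        difference.\<close>
      have "((\<lambda>x. E t x - E s x) has_real_derivative (C 0 t x - \<rho>0) - (C 0 s x - \<rho>0)) (at x)"
        using \<rho>0 jx elim \<open>0 \<le> s\<close> by (intro DERIV_diff) auto
      then show "((\<lambda>x. E t x - E s x) has_real_derivative C 0 t x - C 0 s x) (at x)" by simp
      show "\<bar>C 0 t x - C 0 s x\<bar> \<le> \<epsilon> / L" using elim jx by force
    qed (use E elim assms in \<open>auto intro!: has_periodic_potential_diff continuous_intros\<close>)
    then show ?case using \<open>0 < L\<close> by simp
  qed
qed

lemma dg_field_norm_continuous:
  assumes "0 < L" "mesh L Nx xp" "1 \<le> N" and sol: "dg_hermite_solution L Nx xp k N \<nu> \<alpha> C f\<delta> E"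
  shows "continuous_on {0..} (\<lambda>t. enn2real (Linf_norm L (E t)))"
  unfolding continuous_on
proof (intro ballI tendstoI)
  fix s e :: real assume s: "s \<in> {0..}" and "e > 0"
  have E: "\<forall>t\<ge>0. continuous_on UNIV (E t)"
    using dg_hermite_solution_field[OF sol] by blast
  have "\<forall>\<^sub>F t in at s within {0..}. \<forall>x. \<bar>E t x - E s x\<bar> \<le> e / 2"
    using dg_field_continuous[OF assms, of s "e / 2"] s \<open>e > 0\<close> by simp
  moreover have "\<forall>\<^sub>F t in at s within {0..}. 0 \<le> t" by (simp add: eventually_at_filter)
  ultimately show "\<forall>\<^sub>F t in at s within {0..}. dist (enn2real (Linf_norm L (E t))) (enn2real (Linf_norm L (E s))) < e"
  proof eventually_elim
    case (elim t)
    then have "\<bar>enn2real (Linf_norm L (E t)) - enn2real (Linf_norm L (E s))\<bar> \<le> e / 2"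
      using E s by (intro Linf_norm_close) auto
    then show ?case using \<open>e > 0\<close> by (simp add: dist_real_def)
  qed
qed

section \<open>The differential equation of the scaling function\<close>

text \<open>With \<alpha> equal to \<open>\<alpha>0 * B t powr (- 1 / 2)\<close>, differentiation
  produces \<open>B t powr (- 3 / 2)\<close>, and this times the cube of \<alpha>0 is the cube of
  \<alpha>. Continuity of the norm makes the integral in \<open>B\<close> differentiable at every
  time.\<close>

lemma alpha_of_derivative:
  assumes "0 < \<alpha>0" "0 < \<gamma>"
    and cont: "continuous_on {0..} (\<lambda>s. enn2real (Linf_norm L (E s)))" and "0 \<le> t"
  shows "(alpha_of L \<alpha>0 \<gamma> E has_real_derivative
      - (\<gamma> / 2) * alpha_of L \<alpha>0 \<gamma> E t ^ 3 * max 1 ((enn2real (Linf_norm L (E t)))\<^sup>2)) (at t within {0..})"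
proof -
  define m where "m s = max 1 ((enn2real (Linf_norm L (E s)))\<^sup>2)" for s
  define B where "B s = 1 + \<gamma> * \<alpha>0\<^sup>2 * integral {0..s} m" for s
  have m: "continuous_on {0..} m" unfolding m_def by (intro continuous_intros cont)
  \<comment> \<open>The fundamental theorem is applied on a compact interval; the choice
    \<open>t + 1\<close> leaves the filter at \<open>t\<close> unchanged.\<close>
  have "at t within {0..} = at t within {0..t + 1}"
    by (rule at_within_nhd[of _ "{..<t + 1}"]) auto
  moreover have "((\<lambda>s. integral {0..s} m) has_real_derivative m t) (at t within {0..t + 1})"
    using m \<open>0 \<le> t\<close> by (intro integral_has_real_derivative) (auto intro: continuous_on_subset)
  ultimately have "(B has_real_derivative \<gamma> * \<alpha>0\<^sup>2 * m t) (at t within {0..})"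
    unfolding B_def by (auto intro!: derivative_eq_intros)
  moreover have "integral {0..t} m \<ge> 0"
    by (intro integral_nonneg integrable_continuous_real continuous_on_subset[OF m]) (auto simp: m_def)
  then have B: "B t > 0"
    using assms by (simp add: B_def add_pos_nonneg)
  ultimately have "((\<lambda>s. \<alpha>0 * B s powr (- 1 / 2)) has_real_derivative
      \<alpha>0 * (- 1 / 2 * B t powr (- 1 / 2 - 1) * (\<gamma> * \<alpha>0\<^sup>2 * m t))) (at t within {0..})"
    by (auto intro!: derivative_eq_intros DERIV_fun_powr)
  moreover have "- (\<gamma> / 2) * (\<alpha>0 * B t powr (- 1 / 2)) ^ 3 * m t =
      \<alpha>0 * (- 1 / 2 * B t powr (- 1 / 2 - 1) * (\<gamma> * \<alpha>0\<^sup>2 * m t))"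
  proof -
    have "(B t powr (- 1 / 2)) ^ 3 = B t powr (- 1 / 2 * 3)"
      using B powr_powr[of "B t" "- 1 / 2" 3] by simp
    then show ?thesis by (simp add: power_mult_distrib power2_eq_square power3_eq_cube)
  qed
  ultimately show ?thesis
    unfolding alpha_of_def m_def[symmetric] B_def[symmetric] by (simp only:)
qed

section \<open>The energy identity with a weight\<close>

text \<open>The function \<open>J t * exp (- c * t)\<close> is nonincreasing. As the derivative at 0
  is one-sided, monotonicity is derived from the open interval together with continuity up to the
  endpoints.\<close>

lemma gronwall_nonincreasing:
  fixes J :: "real \<Rightarrow> real"
  assumes "\<And>t. t \<ge> 0 \<Longrightarrow> (J has_real_derivative J' t) (at t within {0..})"
    and "\<And>t. t \<ge> 0 \<Longrightarrow> J' t \<le> c * J t" and "0 \<le> T"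
  shows "J T \<le> J 0 * exp (c * T)"
proof -
  define G where "G t = J t * exp (- c * t)" for t
  have G: "(G has_real_derivative (J' t - c * J t) * exp (- c * t)) (at t within {0..})" if "t \<ge> 0" for t
    unfolding G_def using assms(1)[OF that]
    by (auto intro!: derivative_eq_intros simp: algebra_simps)
  have "G 0 \<ge> G T"
  proof (rule DERIV_nonpos_imp_decreasing_open[OF \<open>0 \<le> T\<close>])
    fix t :: real assume "0 < t" "t < T"
    then have "(G has_real_derivative (J' t - c * J t) * exp (- c * t)) (at t)"
      using G[of t] at_within_interior[of t "{0..}"] by simp
    moreover have "(J' t - c * J t) * exp (- c * t) \<le> 0"
      using assms(2)[of t] \<open>0 < t\<close> by (simp add: mult_le_0_iff)
    ultimately show "\<exists>y. DERIV G t :> y \<and> y \<le> 0" by blast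
  next
    have "continuous_on {0..} G" using G by (intro DERIV_continuous_on) auto
    then show "continuous_on {0..T} G" by (rule continuous_on_subset) auto
  qed
  then have "J T * exp (- c * T) * exp (c * T) \<le> J 0 * exp (c * T)"
    by (intro mult_right_mono) (auto simp: G_def)
  then show ?thesis by (simp add: exp_minus field_simps)
qed

lemma continuous_on_time_compose3:
  fixes g :: "real \<Rightarrow> real \<Rightarrow> real \<Rightarrow> real"
  assumes "continuous_on ({0..} \<times> UNIV \<times> UNIV) (\<lambda>(t, x, v). g t x v)"
    and "continuous_on S a" "continuous_on S b" "continuous_on S d" "\<And>p. p \<in> S \<Longrightarrow> 0 \<le> a p"
  shows "continuous_on S (\<lambda>p. g (a p) (b p) (d p))"
  using continuous_on_compose2[OF assms(1), of S "\<lambda>p. (a p, b p, d p)"] assms(2-5)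
  by (simp add: image_subset_iff continuous_on_Pair)

lemma continuous_on_time_compose2:
  fixes g :: "real \<Rightarrow> real \<Rightarrow> real"
  assumes "continuous_on ({0..} \<times> UNIV) (\<lambda>(t, x). g t x)"
    and "continuous_on S a" "continuous_on S b" "\<And>p. p \<in> S \<Longrightarrow> 0 \<le> a p"
  shows "continuous_on S (\<lambda>p. g (a p) (b p))"
  using continuous_on_compose2[OF assms(1), of S "\<lambda>p. (a p, b p)"] assms(2-4)
  by (simp add: image_subset_iff continuous_on_Pair)

text \<open>Multiply the equation by \<open>2 * f * W\<close> and integrate over one period times
  \<open>{- R..R}\<close>. The boundary terms vanish in \<open>x\<close> by periodicity and in
  \<open>v\<close> because \<open>W\<close> is zero at both ends; what remains is the square of
  \<open>f\<close> times the derivative of \<open>W\<close> along characteristics, at most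
  \<open>c * W\<close>.\<close>

lemma weighted_transport_energy:
  fixes f ft fx fv :: "real \<Rightarrow> real \<Rightarrow> real \<Rightarrow> real" and E W Wt Wv :: "real \<Rightarrow> real \<Rightarrow> real"
  assumes "0 < L" "0 < R" "0 \<le> T"
    and cont: "continuous_on ({0..} \<times> UNIV \<times> UNIV) (\<lambda>(t, x, v). f t x v)"
      "continuous_on ({0..} \<times> UNIV \<times> UNIV) (\<lambda>(t, x, v). ft t x v)"
      "continuous_on ({0..} \<times> UNIV \<times> UNIV) (\<lambda>(t, x, v). fx t x v)"
      "continuous_on ({0..} \<times> UNIV \<times> UNIV) (\<lambda>(t, x, v). fv t x v)"
      "continuous_on ({0..} \<times> UNIV) (\<lambda>(t, x). E t x)"
      "continuous_on ({0..} \<times> UNIV) (\<lambda>(t, v). W t v)"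
      "continuous_on ({0..} \<times> UNIV) (\<lambda>(t, v). Wt t v)"
      "continuous_on ({0..} \<times> UNIV) (\<lambda>(t, v). Wv t v)"
    and ft: "\<And>t x v. 0 \<le> t \<Longrightarrow> ((\<lambda>s. f s x v) has_real_derivative ft t x v) (at t within {0..})"
    and fx: "\<And>t x v. 0 \<le> t \<Longrightarrow> ((\<lambda>y. f t y v) has_real_derivative fx t x v) (at x)"
    and fv: "\<And>t x v. 0 \<le> t \<Longrightarrow> ((\<lambda>w. f t x w) has_real_derivative fv t x v) (at v)"
    and Wt: "\<And>t v. 0 \<le> t \<Longrightarrow> ((\<lambda>s. W s v) has_real_derivative Wt t v) (at t within {0..})"
    and Wv: "\<And>t v. 0 \<le> t \<Longrightarrow> (W t has_real_derivative Wv t v) (at v)"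
    and eq: "\<And>t x v. 0 \<le> t \<Longrightarrow> ft t x v + v * fx t x v + E t x * fv t x v = 0"
    and per: "\<And>t v. 0 \<le> t \<Longrightarrow> f t L v = f t 0 v"
    and W0: "\<And>t. 0 \<le> t \<Longrightarrow> W t R = 0" "\<And>t. 0 \<le> t \<Longrightarrow> W t (- R) = 0"
    and W: "\<And>t x v. 0 \<le> t \<Longrightarrow> x \<in> {0..L} \<Longrightarrow> Wt t v + E t x * Wv t v \<le> c * W t v"
  defines "J \<equiv> \<lambda>t. integral (cbox (0, - R) (L, R)) (\<lambda>(x, v). (f t x v)\<^sup>2 * W t v)"
  shows "J T \<le> J 0 * exp (c * T)"
proof -
  let ?B = "cbox (0, - R) (L, R) :: (real \<times> real) set"
  note comp = cont(1-4)[THEN continuous_on_time_compose3] cont(5-8)[THEN continuous_on_time_compose2]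
  define G where "G t x v = (f t x v)\<^sup>2 * W t v" for t x v
  define Gt where "Gt t x v = 2 * f t x v * ft t x v * W t v + (f t x v)\<^sup>2 * Wt t v" for t x v
  \<comment> \<open>\<open>Gx\<close> and \<open>Gv\<close> are the divergence terms: the
    \<open>x\<close>-derivative of \<open>v * f\<^sup>2 * W\<close> and the
    \<open>v\<close>-derivative of \<open>E * f\<^sup>2 * W\<close>. Here \<open>W\<close> does not
    depend on \<open>x\<close>, nor \<open>E\<close> on \<open>v\<close>.\<close>
  define Gx where "Gx t x v = 2 * f t x v * fx t x v * (v * W t v)" for t x v
  define Gv where "Gv t x v = E t x * (2 * f t x v * fv t x v * W t v + (f t x v)\<^sup>2 * Wv t v)" for t x v
  note [continuous_intros] = comp
  have contB: "continuous_on ?B (\<lambda>(x, v). G t x v)" "continuous_on ?B (\<lambda>(x, v). Gt t x v)"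
      "continuous_on ?B (\<lambda>(x, v). Gx t x v)" "continuous_on ?B (\<lambda>(x, v). Gv t x v)" if "0 \<le> t" for t
    unfolding split_beta G_def Gt_def Gx_def Gv_def using that by (auto intro!: continuous_intros)
  have J: "(J has_real_derivative integral ?B (\<lambda>(x, v). Gt t x v)) (at t within {0..})" if "0 \<le> t" for t
  proof -
    have J_eq: "J = (\<lambda>t. integral ?B ((\<lambda>t (x, v). G t x v) t))" by (simp add: J_def G_def)
    show ?thesis unfolding J_eq
    proof (rule leibniz_rule_field_derivative)
      fix t :: real and z :: "real \<times> real" assume "t \<in> {0..}"
      then have t: "0 \<le> t" by simp
      have "((\<lambda>t. G t x v) has_real_derivative Gt t x v) (at t within {0..})" for x v
        unfolding G_def Gt_def using ft[OF t] Wt[OF t]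
        by (auto intro!: derivative_eq_intros simp: algebra_simps)
      then show "((\<lambda>t. case z of (x, v) \<Rightarrow> G t x v) has_real_derivative (case z of (x, v) \<Rightarrow> Gt t x v))
          (at t within {0..})"
        by (simp add: split_beta)
    next
      fix t :: real assume "t \<in> {0..}"
      then show "(\<lambda>(x, v). G t x v) integrable_on ?B" using contB(1) by (intro integrable_continuous) auto
    next
      show "continuous_on ({0..} \<times> ?B) (\<lambda>(t, x, v). Gt t x v)"
        unfolding split_beta Gt_def by (auto intro!: continuous_intros)
    qed (use that in auto)
  qed
  have intx: "integral ?B (\<lambda>(x, v). Gx t x v) = 0" if "0 \<le> t" for t
  proof -
    have "integral {0..L} (\<lambda>x. Gx t x v) = 0" for v
    proof -
      have "((\<lambda>x. Gx t x v) has_integral (f t L v)\<^sup>2 * (v * W t v) - (f t 0 v)\<^sup>2 * (v * W t v)) {0..L}"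
        using \<open>0 < L\<close> fx[OF that, THEN DERIV_subset, OF subset_UNIV]
        unfolding Gx_def
        by (intro fundamental_theorem_of_calculus)
          (auto intro!: derivative_eq_intros simp flip: has_real_derivative_iff_has_vector_derivative)
      then show ?thesis using per[OF that] by (simp add: has_integral_iff)
    qed
    then have "integral {- R..R} (\<lambda>v. integral {0..L} (\<lambda>x. Gx t x v)) = 0" by simp
    then show ?thesis
      using integral_prod_continuous[OF contB(3)[OF that]] integral_swap_continuous[OF contB(3)[OF that]] by simp
  qed
  have intv: "integral ?B (\<lambda>(x, v). Gv t x v) = 0" if "0 \<le> t" for t
  proof -
    have "integral {- R..R} (\<lambda>v. Gv t x v) = 0" for x
    proof -
      have "((\<lambda>v. Gv t x v) has_integral E t x * ((f t x R)\<^sup>2 * W t R) - E t x * ((f t x (- R))\<^sup>2 * W t (- R))) {- R..R}"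
        using \<open>0 < R\<close> fv[OF that, THEN DERIV_subset, OF subset_UNIV] Wv[OF that, THEN DERIV_subset, OF subset_UNIV]
        unfolding Gv_def
        by (intro fundamental_theorem_of_calculus)
          (auto intro!: derivative_eq_intros simp flip: has_real_derivative_iff_has_vector_derivative)
      then show ?thesis using W0[OF that] by (simp add: has_integral_iff)
    qed
    then show ?thesis
      using integral_prod_continuous[OF contB(4)[OF that]] by simp
  qed
  \<comment> \<open>Add the two vanishing integrals so that the transport equation cancels all derivatives of \<open>f\<close>.\<close>
  have "integral ?B (\<lambda>(x, v). Gt t x v) \<le> c * J t" if "0 \<le> t" for t
  proof -
    note int = contB[OF that, THEN integrable_continuous]
    have "integral ?B (\<lambda>(x, v). Gt t x v) =
        integral ?B (\<lambda>z. (case z of (x, v) \<Rightarrow> Gt t x v) + (case z of (x, v) \<Rightarrow> Gx t x v) + (case z of (x, v) \<Rightarrow> Gv t x v))"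
      using int intx[OF that] intv[OF that] by (simp add: integral_add integrable_add)
    also have "\<dots> \<le> integral ?B (\<lambda>z. c * (case z of (x, v) \<Rightarrow> G t x v))"
    proof (rule integral_le)
      fix z assume "z \<in> ?B"
      then obtain x v where z: "z = (x, v)" "x \<in> {0..L}" by (cases z) (auto simp: cbox_Pair_eq)
      have "Gt t x v + Gx t x v + Gv t x v =
          2 * f t x v * W t v * (ft t x v + v * fx t x v + E t x * fv t x v) + (f t x v)\<^sup>2 * (Wt t v + E t x * Wv t v)"
        by (simp add: Gt_def Gx_def Gv_def algebra_simps)
      also have "\<dots> \<le> (f t x v)\<^sup>2 * (c * W t v)"
        using eq[OF that] W[OF that z(2)] by (simp add: mult_left_mono)
      finally show "(case z of (x, v) \<Rightarrow> Gt t x v) + (case z of (x, v) \<Rightarrow> Gx t x v) + (case z of (x, v) \<Rightarrow> Gv t x v)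
          \<le> c * (case z of (x, v) \<Rightarrow> G t x v)"
        by (simp add: z G_def algebra_simps)
    qed (intro integrable_add int integrable_on_mult_right)+
    also have "\<dots> = c * J t" by (simp add: J_def G_def)
    finally show ?thesis .
  qed
  then show ?thesis using J \<open>0 \<le> T\<close> by (intro gronwall_nonincreasing) auto
qed

text \<open>Squaring removes the kink of the positive part: at 0 the difference quotient is at most
  \<open>\<bar>h\<bar>\<close>.\<close>

lemma max_0_square_derivative: "((\<lambda>y::real. (max 0 y)\<^sup>2) has_real_derivative 2 * max 0 y) (at y)"
proof -
  consider "y < 0" | "y = 0" | "y > 0" by linarith
  then show ?thesis
  proof cases
    case 1
    have "((\<lambda>y::real. 0) has_real_derivative 2 * max 0 y) (at y)" using 1 by simp
    then show ?thesis
      by (rule has_field_derivative_transform_within_open[of _ _ _ "{..<0}"]) (use 1 in auto)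
  next
    case 2
    have "((\<lambda>h::real. (max 0 h)\<^sup>2 / h) \<longlongrightarrow> 0) (at 0)"
    proof (rule Lim_null_comparison[OF always_eventually tendsto_rabs_zero[OF tendsto_ident_at]]; rule allI)
      fix h :: real show "norm ((max 0 h)\<^sup>2 / h) \<le> \<bar>h\<bar>"
        by (cases "h > 0") (auto simp: power2_eq_square)
    qed
    then show ?thesis using 2 by (simp add: DERIV_def)
  next
    case 3
    have "((\<lambda>y::real. y\<^sup>2) has_real_derivative 2 * max 0 y) (at y)"
      using 3 by (auto intro!: derivative_eq_intros)
    then show ?thesis
      by (rule has_field_derivative_transform_within_open[of _ _ _ "{0<..}"]) (use 3 in auto)
  qed
qed

section \<open>The cutoff\<close>

text \<open>
  With \<open>K \<ge> \<bar>E\<bar>\<close> the drift \<open>K t\<close> makes the cutoff nonincreasing along characteristics; it is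
  squared below to be of class \<open>C\<^sup>1\<close>.
\<close>

definition cutoff :: "real \<Rightarrow> real \<Rightarrow> real \<Rightarrow> real \<Rightarrow> real" where
  "cutoff K R t v = max 0 (1 - (K * t + sqrt (1 + v\<^sup>2)) / R)"

lemma sqrt_one_plus_square_pos: "0 < sqrt (1 + v\<^sup>2)" for v :: real
  by (simp add: add_pos_nonneg)

text \<open>This controls the smooth substitute for the absolute value in two ways: its slope is
  bounded by 1, and the cutoff vanishes once \<open>\<bar>v\<bar>\<close> reaches
  \<open>R\<close>.\<close>

lemma abs_less_sqrt_one_plus_square: "\<bar>v\<bar> < sqrt (1 + v\<^sup>2)" for v :: real
  by (rule real_less_rsqrt) simp

lemma cutoff_derivatives:
  shows "((\<lambda>t. (cutoff K R t v)\<^sup>2) has_real_derivative 2 * cutoff K R t v * (- K / R)) (at t)"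
    and "((\<lambda>v. (cutoff K R t v)\<^sup>2) has_real_derivative
      2 * cutoff K R t v * (- (v / sqrt (1 + v\<^sup>2)) / R)) (at v)"
proof -
  \<comment> \<open>For \<open>R = 0\<close> division gives 0 on both sides, so the function is
    constant and the formula still holds.\<close>
  have "((\<lambda>t. 1 - (K * t + sqrt (1 + v\<^sup>2)) / R) has_real_derivative - K / R) (at t)"
    by (cases "R = 0") (auto intro!: derivative_eq_intros)
  then show "((\<lambda>t. (cutoff K R t v)\<^sup>2) has_real_derivative 2 * cutoff K R t v * (- K / R)) (at t)"
    unfolding cutoff_def by (rule DERIV_chain2[OF max_0_square_derivative])
  have "((\<lambda>v. 1 - (K * t + sqrt (1 + v\<^sup>2)) / R) has_real_derivative - (v / sqrt (1 + v\<^sup>2)) / R) (at v)"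
  proof -
    have "0 < 1 + v\<^sup>2" by (simp add: add_pos_nonneg)
    moreover have "((\<lambda>v. 1 + v\<^sup>2) has_real_derivative 2 * v) (at v)"
      by (auto intro!: derivative_eq_intros)
    ultimately have "((\<lambda>v. sqrt (1 + v\<^sup>2)) has_real_derivative inverse (sqrt (1 + v\<^sup>2)) / 2 * (2 * v)) (at v)"
      by (rule DERIV_chain2[OF DERIV_real_sqrt])
    then have "((\<lambda>v. 1 - (K * t + sqrt (1 + v\<^sup>2)) / R) has_real_derivative
        0 - (0 + inverse (sqrt (1 + v\<^sup>2)) / 2 * (2 * v)) / R) (at v)"
      by (intro DERIV_diff DERIV_cdivide DERIV_add DERIV_const)
    moreover have eq: "0 - (0 + inverse s / 2 * (2 * v)) / R = - (v / s) / R" for s :: real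
      by (cases "s = 0"; cases "R = 0") (simp_all add: field_simps)
    ultimately show ?thesis by (simp only: eq)
  qed
  then show "((\<lambda>v. (cutoff K R t v)\<^sup>2) has_real_derivative
      2 * cutoff K R t v * (- (v / sqrt (1 + v\<^sup>2)) / R)) (at v)"
    unfolding cutoff_def by (rule DERIV_chain2[OF max_0_square_derivative])
qed

text \<open>The drift can only shrink the support, so one box in \<open>v\<close> contains it at all
  times and the cutoff is zero at both ends \<open>R\<close> and \<open>- R\<close>.\<close>

lemma cutoff_range:
  assumes "0 < R" "0 \<le> K" "0 \<le> t"
  shows "0 \<le> cutoff K R t v" "cutoff K R t v \<le> 1"
    and "R \<le> \<bar>v\<bar> \<Longrightarrow> cutoff K R t v = 0"
proof -
  have s: "0 \<le> K * t + sqrt (1 + v\<^sup>2)" using assms sqrt_one_plus_square_pos[of v] by simp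
  show "0 \<le> cutoff K R t v" "cutoff K R t v \<le> 1"
    using s assms by (auto simp: cutoff_def)
  assume "R \<le> \<bar>v\<bar>"
  moreover have "0 \<le> K * t" using assms by simp
  ultimately have "R \<le> K * t + sqrt (1 + v\<^sup>2)" using abs_less_sqrt_one_plus_square[of v] by linarith
  then show "cutoff K R t v = 0" using assms by (simp add: cutoff_def)
qed

lemma cutoff_tendsto: "(\<lambda>n. cutoff K (real (Suc n)) t v) \<longlonglongrightarrow> 1"
proof -
  have "(\<lambda>n. (K * t + sqrt (1 + v\<^sup>2)) * inverse (real (Suc n))) \<longlonglongrightarrow> (K * t + sqrt (1 + v\<^sup>2)) * 0"
    by (intro tendsto_intros LIMSEQ_inverse_real_of_nat)
  then have "(\<lambda>n. max 0 (1 - (K * t + sqrt (1 + v\<^sup>2)) / real (Suc n))) \<longlonglongrightarrow> max 0 (1 - 0)"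
    by (intro tendsto_intros) (simp add: divide_inverse)
  then show ?thesis by (simp add: cutoff_def)
qed

lemma weight_pos: "0 < weight \<alpha> t v"
  by (simp add: weight_def)

text \<open>Along characteristics the weight grows at rate at most \<open>c\<close>, by hypothesis.
  The squared cutoff contributes a nonnegative factor times
  \<open>- K - E t x * (v / sqrt (1 + v\<^sup>2))\<close>, which is nonpositive because the field is
  bounded by \<open>K\<close> and the quotient by 1.\<close>

lemma cutoff_energy:
  fixes f ft fx fv :: "real \<Rightarrow> real \<Rightarrow> real \<Rightarrow> real" and E :: "real \<Rightarrow> real \<Rightarrow> real"
  assumes "0 < L" "0 < R" "0 \<le> T"
    and cont: "continuous_on ({0..} \<times> UNIV \<times> UNIV) (\<lambda>(t, x, v). f t x v)"
      "continuous_on ({0..} \<times> UNIV \<times> UNIV) (\<lambda>(t, x, v). ft t x v)"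
      "continuous_on ({0..} \<times> UNIV \<times> UNIV) (\<lambda>(t, x, v). fx t x v)"
      "continuous_on ({0..} \<times> UNIV \<times> UNIV) (\<lambda>(t, x, v). fv t x v)"
      "continuous_on ({0..} \<times> UNIV) (\<lambda>(t, x). E t x)"
    and ft: "\<And>t x v. 0 \<le> t \<Longrightarrow> ((\<lambda>s. f s x v) has_real_derivative ft t x v) (at t within {0..})"
    and fx: "\<And>t x v. 0 \<le> t \<Longrightarrow> ((\<lambda>y. f t y v) has_real_derivative fx t x v) (at x)"
    and fv: "\<And>t x v. 0 \<le> t \<Longrightarrow> ((\<lambda>w. f t x w) has_real_derivative fv t x v) (at v)"
    and eq: "\<And>t x v. 0 \<le> t \<Longrightarrow> ft t x v + v * fx t x v + E t x * fv t x v = 0"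
    and per: "\<And>t v. 0 \<le> t \<Longrightarrow> f t L v = f t 0 v"
    and K: "0 \<le> K" "\<And>t x. 0 \<le> t \<Longrightarrow> x \<in> {0..L} \<Longrightarrow> \<bar>E t x\<bar> \<le> K"
    and \<alpha>: "\<And>t. 0 \<le> t \<Longrightarrow> (\<alpha> has_real_derivative \<alpha>' t) (at t within {0..})" "continuous_on {0..} \<alpha>'"
    and c: "\<And>t x v. 0 \<le> t \<Longrightarrow> x \<in> {0..L} \<Longrightarrow> \<alpha> t * \<alpha>' t * v\<^sup>2 + E t x * (\<alpha> t)\<^sup>2 * v \<le> c"
  defines "J \<equiv> \<lambda>t. integral (cbox (0, - R) (L, R)) (\<lambda>(x, v). (f t x v)\<^sup>2 * (weight \<alpha> t v * (cutoff K R t v)\<^sup>2))"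
  shows "J T \<le> J 0 * exp (c * T)"
proof -
  have cont_\<alpha>: "continuous_on {0..} \<alpha>" using \<alpha>(1) by (intro DERIV_continuous_on) auto
  have comp: "continuous_on ({0..} \<times> UNIV) (\<lambda>p :: real \<times> real. g (fst p))" if "continuous_on {0..} g" for g :: "real \<Rightarrow> real"
    by (rule continuous_on_compose2[OF that]) (auto intro!: continuous_intros)
  note [continuous_intros] = comp[OF cont_\<alpha>] comp[OF \<alpha>(2)]
  define Wt where "Wt t v = weight \<alpha> t v * (\<alpha> t * \<alpha>' t * v\<^sup>2) * (cutoff K R t v)\<^sup>2 +
    weight \<alpha> t v * (2 * cutoff K R t v * (- K / R))" for t v
  define Wv where "Wv t v = weight \<alpha> t v * ((\<alpha> t)\<^sup>2 * v) * (cutoff K R t v)\<^sup>2 +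
    weight \<alpha> t v * (2 * cutoff K R t v * (- (v / sqrt (1 + v\<^sup>2)) / R))" for t v
  show ?thesis unfolding J_def
  proof (rule weighted_transport_energy[OF assms(1-3) cont, of _ Wt Wv])
    show "continuous_on ({0..} \<times> UNIV) (\<lambda>(t, v). weight \<alpha> t v * (cutoff K R t v)\<^sup>2)"
      unfolding split_beta weight_def cutoff_def using \<open>0 < R\<close> by (intro continuous_intros) auto
    show "continuous_on ({0..} \<times> UNIV) (\<lambda>(t, v). Wt t v)"
      unfolding split_beta Wt_def weight_def cutoff_def using \<open>0 < R\<close> by (intro continuous_intros) auto
    show "continuous_on ({0..} \<times> UNIV) (\<lambda>(t, v). Wv t v)"
      unfolding split_beta Wv_def weight_def cutoff_def using \<open>0 < R\<close>
      by (intro continuous_intros ballI sqrt_one_plus_square_pos[THEN less_imp_neq, symmetric]) auto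
  next
    fix t v :: real assume t: "0 \<le> t"
    have "((\<lambda>s. weight \<alpha> s v) has_real_derivative weight \<alpha> t v * (\<alpha> t * \<alpha>' t * v\<^sup>2)) (at t within {0..})"
      unfolding weight_def using \<alpha>(1)[OF t]
      by (auto intro!: derivative_eq_intros simp: algebra_simps)
    from DERIV_mult[OF this DERIV_subset[OF cutoff_derivatives(1)[of K R v t] subset_UNIV]]
    show "((\<lambda>s. weight \<alpha> s v * (cutoff K R s v)\<^sup>2) has_real_derivative Wt t v) (at t within {0..})"
      unfolding Wt_def by (simp add: mult.commute add.commute)
    have "(weight \<alpha> t has_real_derivative weight \<alpha> t v * ((\<alpha> t)\<^sup>2 * v)) (at v)"
      unfolding weight_def by (auto intro!: derivative_eq_intros simp: algebra_simps power2_eq_square)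
    from DERIV_mult[OF this cutoff_derivatives(2)[of K R t v]]
    show "((\<lambda>v. weight \<alpha> t v * (cutoff K R t v)\<^sup>2) has_real_derivative Wv t v) (at v)"
      unfolding Wv_def by (simp add: mult.commute add.commute)
  next
    fix t assume t: "0 \<le> (t::real)"
    show "weight \<alpha> t R * (cutoff K R t R)\<^sup>2 = 0" "weight \<alpha> t (- R) * (cutoff K R t (- R))\<^sup>2 = 0"
      using cutoff_range(3)[OF \<open>0 < R\<close> K(1) t, of R] cutoff_range(3)[OF \<open>0 < R\<close> K(1) t, of "- R"] by auto
  next
    fix t x v :: real assume t: "0 \<le> t" and x: "x \<in> {0..L}"
    \<comment> \<open>\<open>w\<close> is the common nonnegative factor of both derivatives of the
      squared cutoff, multiplied by the weight.\<close>
    define w where "w = weight \<alpha> t v * (2 * cutoff K R t v / R)"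
    have "0 \<le> w"
      using weight_pos[of \<alpha> t v] cutoff_range(1)[OF \<open>0 < R\<close> K(1) t, of v] \<open>0 < R\<close> by (simp add: w_def)
    have "\<bar>v / sqrt (1 + v\<^sup>2)\<bar> \<le> 1"
      using less_imp_le[OF abs_less_sqrt_one_plus_square[of v]]
      unfolding abs_divide abs_of_pos[OF sqrt_one_plus_square_pos]
      by (simp only: divide_le_eq_1_pos[OF sqrt_one_plus_square_pos])
    then have "\<bar>E t x * (v / sqrt (1 + v\<^sup>2))\<bar> \<le> K * 1"
      unfolding abs_mult using K(2)[OF t x] K(1) by (intro mult_mono) auto
    then have "w * (- K - E t x * (v / sqrt (1 + v\<^sup>2))) \<le> 0"
      using \<open>0 \<le> w\<close> by - (rule mult_nonneg_nonpos, linarith+)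
    moreover have "weight \<alpha> t v * (cutoff K R t v)\<^sup>2 * (\<alpha> t * \<alpha>' t * v\<^sup>2 + E t x * (\<alpha> t)\<^sup>2 * v) \<le>
        weight \<alpha> t v * (cutoff K R t v)\<^sup>2 * c"
      using c[OF t x, of v] weight_pos[of \<alpha> t v] by (intro mult_left_mono) auto
    moreover have "Wt t v + E t x * Wv t v =
        weight \<alpha> t v * (cutoff K R t v)\<^sup>2 * (\<alpha> t * \<alpha>' t * v\<^sup>2 + E t x * (\<alpha> t)\<^sup>2 * v) +
        w * (- K - E t x * (v / sqrt (1 + v\<^sup>2)))"
      unfolding Wt_def Wv_def w_def by (simp add: divide_inverse algebra_simps)
    ultimately show "Wt t v + E t x * Wv t v \<le> c * (weight \<alpha> t v * (cutoff K R t v)\<^sup>2)"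
      by (simp add: mult.commute)
  qed (use assms in blast)+
qed

section \<open>Integrals over the torus times the velocity line\<close>

text \<open>\<open>torus_measure L\<close> carries the trace sigma-algebra on \<open>{0..L}\<close>,
  so Borel functions on the plane are pulled back along the inclusion.\<close>

lemma borel_measurable_torus_times:
  assumes "continuous_on UNIV (g :: real \<times> real \<Rightarrow> real)"
  shows "g \<in> borel_measurable (torus_measure L \<Otimes>\<^sub>M lborel)"
proof -
  have 1: "g \<in> borel_measurable (borel \<Otimes>\<^sub>M borel)"
    using borel_measurable_continuous_onI[OF assms] by (simp add: borel_prod)
  have 2: "(\<lambda>z :: real \<times> real. (fst z, snd z)) \<in> torus_measure L \<Otimes>\<^sub>M lborel \<rightarrow>\<^sub>M borel \<Otimes>\<^sub>M borel"
  proof (rule measurable_Pair)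
    have "(\<lambda>x. x) \<in> torus_measure L \<rightarrow>\<^sub>M borel"
      unfolding torus_measure_def by (rule measurable_restrict_space1) simp
    from measurable_compose[OF measurable_fst[of _ "lborel :: real measure"] this]
    show "fst \<in> torus_measure L \<Otimes>\<^sub>M (lborel :: real measure) \<rightarrow>\<^sub>M borel" by simp
    show "snd \<in> torus_measure L \<Otimes>\<^sub>M (lborel :: real measure) \<rightarrow>\<^sub>M borel"
      using measurable_snd[of "torus_measure L" "lborel :: real measure"] by simp
  qed
  from measurable_compose[OF 2 1] show ?thesis by simp
qed

text \<open>The bridge between two integrals: the energy estimate differentiates a gauge integral
  over a box, while the norms are Lebesgue integrals over an unbounded strip. Tonelli is used once
  to split off the torus factor and once to reassemble the box.\<close>

lemma nn_integral_torus_times_compact: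
  fixes g :: "real \<times> real \<Rightarrow> real"
  assumes g: "continuous_on UNIV g" "\<And>z. 0 \<le> g z" and zero: "\<And>x v. R \<le> \<bar>v\<bar> \<Longrightarrow> g (x, v) = 0"
  shows "(\<integral>\<^sup>+z. ennreal (g z) \<partial>(torus_measure L \<Otimes>\<^sub>M lborel)) = ennreal (integral (cbox (0, - R) (L, R)) g)"
proof -
  let ?B = "cbox (0, - R) (L, R)"
  have [measurable]: "g \<in> borel_measurable (lborel \<Otimes>\<^sub>M lborel)"
    using borel_measurable_continuous_onI[OF g(1)] by (simp add: lborel_prod)
  have [measurable]: "?B \<in> sets (lborel \<Otimes>\<^sub>M lborel)" unfolding lborel_prod by simp
  have "(\<integral>\<^sup>+z. ennreal (g z) \<partial>(torus_measure L \<Otimes>\<^sub>M lborel)) =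
      (\<integral>\<^sup>+x. \<integral>\<^sup>+v. ennreal (g (x, v)) \<partial>lborel \<partial>torus_measure L)"
    using borel_measurable_torus_times[OF g(1)] by (subst lborel.nn_integral_fst) auto
  also have "\<dots> = (\<integral>\<^sup>+x. (\<integral>\<^sup>+v. ennreal (g (x, v)) \<partial>lborel) * indicator {0..L} x \<partial>lborel)"
    unfolding torus_measure_def by (rule nn_integral_restrict_space) simp
  also have "\<dots> = (\<integral>\<^sup>+x. \<integral>\<^sup>+v. ennreal (g (x, v)) * indicator ?B (x, v) \<partial>lborel \<partial>lborel)"
  proof (rule nn_integral_cong)
    fix x :: real
    have "ennreal (g (x, v)) * indicator ?B (x, v) = (if x \<in> {0..L} then ennreal (g (x, v)) else 0)" for v
      using zero[of v x] by (auto simp: indicator_def cbox_Pair_eq)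
    then show "(\<integral>\<^sup>+v. ennreal (g (x, v)) \<partial>lborel) * indicator {0..L} x =
        (\<integral>\<^sup>+v. ennreal (g (x, v)) * indicator ?B (x, v) \<partial>lborel)"
      by (cases "x \<in> {0..L}") auto
  qed
  also have "\<dots> = (\<integral>\<^sup>+z. ennreal (g z) * indicator ?B z \<partial>(lborel \<Otimes>\<^sub>M lborel))"
    by (subst lborel.nn_integral_fst) auto
  also have "\<dots> = ennreal (integral ?B g)"
    unfolding lborel_prod
    by (rule nn_integral_has_integral_lebesgue'[OF g(2) integrable_integral[OF
      integrable_continuous[OF continuous_on_subset[OF g(1) subset_UNIV]]]])
  finally show ?thesis .
qed

section \<open>The weighted norm of the solution\<close>

text \<open>The partial derivatives are the total derivative at the unit vectors, by the chain rule
  along coordinate lines. The time line stays in \<open>{0..}\<close>, hence the one-sided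
  derivative at time 0.\<close>

lemma C1_on_partial_derivatives3:
  assumes "C1_on ({0..} \<times> UNIV \<times> UNIV) (\<lambda>(t, x, v). f t x v)"
  obtains ft fx fv :: "real \<Rightarrow> real \<Rightarrow> real \<Rightarrow> real" where
    "continuous_on ({0..} \<times> UNIV \<times> UNIV) (\<lambda>(t, x, v). ft t x v)"
    "continuous_on ({0..} \<times> UNIV \<times> UNIV) (\<lambda>(t, x, v). fx t x v)"
    "continuous_on ({0..} \<times> UNIV \<times> UNIV) (\<lambda>(t, x, v). fv t x v)"
    "\<And>t x v. 0 \<le> t \<Longrightarrow> ((\<lambda>s. f s x v) has_real_derivative ft t x v) (at t within {0..})"
    "\<And>t x v. 0 \<le> t \<Longrightarrow> ((\<lambda>y. f t y v) has_real_derivative fx t x v) (at x)"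
    "\<And>t x v. 0 \<le> t \<Longrightarrow> ((\<lambda>w. f t x w) has_real_derivative fv t x v) (at v)"
proof -
  let ?S = "{0::real..} \<times> (UNIV :: real set) \<times> (UNIV :: real set)"
  let ?F = "\<lambda>(t, x, v). f t x v"
  obtain F' :: "real \<times> real \<times> real \<Rightarrow> (real \<times> real \<times> real) \<Rightarrow>\<^sub>L real" where
    cont: "continuous_on ?S F'" and
    F': "\<And>z. z \<in> ?S \<Longrightarrow> (?F has_derivative blinfun_apply (F' z)) (at z within ?S)"
    using assms unfolding C1_on_def by blast
  have c: "continuous_on ?S (\<lambda>(t, x, v). blinfun_apply (F' (t, x, v)) e)" for e
    using cont by (auto intro!: continuous_intros simp: split_beta)
  have chain: "((\<lambda>s. ?F (a s)) has_real_derivative blinfun_apply (F' (a s)) e) (at s within I)"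
    if "a ` I \<subseteq> ?S" "s \<in> I" "(a has_derivative (\<lambda>h. h *\<^sub>R e)) (at s within I)" for a s e I
    using has_derivative_in_compose2[OF F' that]
    unfolding has_field_derivative_def by (simp add: blinfun.scaleR_right mult_commute_abs)
  show ?thesis
  proof (rule that[of "\<lambda>t x v. F' (t, x, v) (1, 0, 0)" "\<lambda>t x v. F' (t, x, v) (0, 1, 0)" "\<lambda>t x v. F' (t, x, v) (0, 0, 1)"])
    fix t x v :: real assume t: "0 \<le> t"
    have "((\<lambda>s. (s, x, v)) has_derivative (\<lambda>h. h *\<^sub>R (1, 0, 0))) (at t within {0..})"
      by (auto intro!: derivative_eq_intros simp: zero_prod_def)
    from chain[OF _ _ this] show "((\<lambda>s. f s x v) has_real_derivative F' (t, x, v) (1, 0, 0)) (at t within {0..})"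
      using t by (simp add: image_subset_iff)
    have "((\<lambda>y. (t, y, v)) has_derivative (\<lambda>h. h *\<^sub>R (0, 1, 0))) (at x)"
      by (auto intro!: derivative_eq_intros simp: zero_prod_def)
    from chain[OF _ _ this] show "((\<lambda>y. f t y v) has_real_derivative F' (t, x, v) (0, 1, 0)) (at x)"
      using t by (simp add: image_subset_iff)
    have "((\<lambda>w. (t, x, w)) has_derivative (\<lambda>h. h *\<^sub>R (0, 0, 1))) (at v)"
      by (auto intro!: derivative_eq_intros simp: zero_prod_def)
    from chain[OF _ _ this] show "((\<lambda>w. f t x w) has_real_derivative F' (t, x, v) (0, 0, 1)) (at v)"
      using t by (simp add: image_subset_iff)
  qed (rule c)+
qed

lemma C1_on_imp_continuous_on:
  assumes "C1_on S F"
  shows "continuous_on S F"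
proof -
  obtain F' where "\<And>z. z \<in> S \<Longrightarrow> (F has_derivative blinfun_apply (F' z)) (at z within S)"
    using assms unfolding C1_on_def by blast
  then show ?thesis by (rule has_derivative_continuous_on)
qed

text \<open>Both derivatives are restricted to the right of \<open>t\<close>, which also covers
  \<open>t = 0\<close>, where no two-sided derivative is available.\<close>

lemma has_real_derivative_unique_within_Ici:
  fixes t :: real
  assumes "(g has_real_derivative a) (at t within {0..})" "(g has_real_derivative b) (at t within {0..})" "0 \<le> t"
  shows "a = b"
proof -
  have "{t<..} \<subseteq> {0..}" using assms(3) by auto
  then have "(g has_vector_derivative a) (at_right t)" "(g has_vector_derivative b) (at_right t)"
    using assms DERIV_subset[of g _ t "{0..}" "{t<..}"]
    by (auto simp flip: has_real_derivative_iff_has_vector_derivative)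
  then show ?thesis using vector_derivative_unique_within[of t "{t<..}"] by simp
qed

text \<open>For continuous \<open>u\<close> the almost-everywhere bound holds everywhere: a closed
  set of full measure in an open interval contains it, and the closure recovers the
  endpoints.\<close>

lemma Linf_norm_continuous_bound:
  assumes "continuous_on UNIV u" "0 < L" "Linf_norm L u \<le> ennreal B" "0 \<le> B" "x \<in> {0..L}"
  shows "\<bar>u x\<bar> \<le> B"
proof -
  let ?C = "{x. \<bar>u x\<bar> \<le> B}"
  have C: "closed ?C" using assms(1) by (intro closed_Collect_le continuous_intros) auto
  have "AE x in torus_measure L. ennreal \<bar>u x\<bar> \<le> Linf_norm L u"
    unfolding Linf_norm_def by (rule esssup_AE)
  then have "AE x in torus_measure L. x \<in> ?C"
  proof eventually_elim
    case (elim x)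
    then have "ennreal \<bar>u x\<bar> \<le> ennreal B" using assms(3) by (rule order_trans)
    then show ?case using assms(4) by (simp add: ennreal_le_iff)
  qed
  then have "AE x in lborel. x \<in> {0..L} \<longrightarrow> x \<in> ?C"
    unfolding torus_measure_def by (subst (asm) AE_restrict_space_iff) auto
  then have "AE x in lborel. x \<in> {0<..<L} \<longrightarrow> x \<in> ?C" by (rule AE_mp) (auto intro!: AE_I2)
  then have "AE x \<in> {0<..<L} in lebesgue. x \<in> ?C" by (rule AE_completion)
  then have "{0<..<L} \<subseteq> ?C" using mem_closed_if_AE_lebesgue_open[OF open_greaterThanLessThan C] by blast
  then have "closure {0<..<L} \<subseteq> ?C" using C by (rule closure_minimal)
  then show ?thesis using assms(2,5) by (auto simp: closure_greaterThanLessThan)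
qed

lemma ennreal_power2_le_imp_le_sqrt:
  assumes "x\<^sup>2 \<le> ennreal C" "0 \<le> C"
  shows "x \<le> ennreal (sqrt C)"
proof (cases x)
  case (real r)
  then have "r\<^sup>2 \<le> C" using assms by (simp add: ennreal_power ennreal_le_iff)
  then show ?thesis using real by (simp add: real_le_rsqrt ennreal_leI)
next
  case top
  then show ?thesis using assms by (simp add: power2_eq_square ennreal_top_mult top_unique)
qed

lemma nn_integral_mu:
  assumes "continuous_on UNIV (\<lambda>(x, v). g x v)"
  shows "(\<integral>\<^sup>+(x, v). ennreal (\<bar>g x v\<bar>\<^sup>2) \<partial>mu L \<alpha> t) =
    (\<integral>\<^sup>+(x, v). ennreal ((g x v)\<^sup>2 * weight \<alpha> t v) \<partial>(torus_measure L \<Otimes>\<^sub>M lborel))"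
proof -
  have w: "(\<lambda>(x :: real, v). weight \<alpha> t v) \<in> borel_measurable (torus_measure L \<Otimes>\<^sub>M lborel)"
    unfolding weight_def split_beta
    by (intro borel_measurable_torus_times continuous_intros) auto
  have [measurable]: "(\<lambda>(x, v). g x v) \<in> borel_measurable (torus_measure L \<Otimes>\<^sub>M lborel)"
    by (rule borel_measurable_torus_times[OF assms])
  have "(\<integral>\<^sup>+(x, v). ennreal (\<bar>g x v\<bar>\<^sup>2) \<partial>mu L \<alpha> t) =
      (\<integral>\<^sup>+z. (case z of (x, v) \<Rightarrow> ennreal (weight \<alpha> t v)) * (case z of (x, v) \<Rightarrow> ennreal (\<bar>g x v\<bar>\<^sup>2))
        \<partial>(torus_measure L \<Otimes>\<^sub>M lborel))"
    unfolding mu_def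
  proof (rule nn_integral_density)
    show "(\<lambda>(x :: real, v). ennreal (weight \<alpha> t v)) \<in> borel_measurable (torus_measure L \<Otimes>\<^sub>M lborel)"
      using measurable_compose[OF w measurable_ennreal] by (simp add: split_beta')
    show "(\<lambda>(x, v). ennreal (\<bar>g x v\<bar>\<^sup>2)) \<in> borel_measurable (torus_measure L \<Otimes>\<^sub>M lborel)"
      by simp
  qed
  also have "\<dots> = (\<integral>\<^sup>+(x, v). ennreal ((g x v)\<^sup>2 * weight \<alpha> t v) \<partial>(torus_measure L \<Otimes>\<^sub>M lborel))"
    using weight_pos[of \<alpha> t, THEN less_imp_le]
    by (intro nn_integral_cong) (simp add: split_beta mult.commute flip: ennreal_mult)
  finally show ?thesis .
qed

text \<open>Membership and norm are both read off one extended-valued integral, so a single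
  inequality between such integrals gives integrability at later times as well as the
  estimate.\<close>

lemma L2_mu:
  fixes g :: "real \<Rightarrow> real \<Rightarrow> real" and L t :: real and \<alpha> :: "real \<Rightarrow> real"
  assumes "continuous_on UNIV (\<lambda>(x, v). g x v)"
  defines "Q \<equiv> \<integral>\<^sup>+(x, v). ennreal ((g x v)\<^sup>2 * weight \<alpha> t v) \<partial>(torus_measure L \<Otimes>\<^sub>M lborel)"
  shows "in_L2 (mu L \<alpha> t) g \<longleftrightarrow> Q < \<infinity>"
    and "L2_norm (mu L \<alpha> t) g = sqrt (enn2real Q)"
proof -
  have m: "(\<lambda>(x, v). g x v) \<in> borel_measurable (mu L \<alpha> t)"
    using borel_measurable_torus_times[OF assms(1)] by (simp add: mu_def)
  then have m2: "(\<lambda>(x, v). \<bar>g x v\<bar>\<^sup>2) \<in> borel_measurable (mu L \<alpha> t)"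
    using borel_measurable_power[of _ _ 2] by (simp add: split_beta')
  have nn: "(\<integral>\<^sup>+z. ennreal (case z of (x, v) \<Rightarrow> \<bar>g x v\<bar>\<^sup>2) \<partial>mu L \<alpha> t) = Q"
    unfolding Q_def nn_integral_mu[OF assms(1), symmetric] by (intro nn_integral_cong) (simp add: split_beta)
  show "in_L2 (mu L \<alpha> t) g \<longleftrightarrow> Q < \<infinity>"
  proof -
    have "(\<integral>\<^sup>+z. ennreal (norm (case z of (x, v) \<Rightarrow> \<bar>g x v\<bar>\<^sup>2)) \<partial>mu L \<alpha> t) = Q"
      unfolding nn[symmetric] by (intro nn_integral_cong) (simp add: split_beta)
    then show ?thesis unfolding in_L2_def integrable_iff_bounded using m m2 by simp
  qed
  show "L2_norm (mu L \<alpha> t) g = sqrt (enn2real Q)"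
    unfolding L2_norm_def using integral_eq_nn_integral[OF m2] nn by (simp add: split_beta)
qed

text \<open>The cutoff is removed differently at the two ends: at time 0 it is bounded by 1, at time
  \<open>T\<close> it tends to 1 and Fatou's lemma applies. Extended values make sense of the
  inequality before integrability at time \<open>T\<close> is known.\<close>

lemma limit_weighted_energy:
  fixes f ft fx fv :: "real \<Rightarrow> real \<Rightarrow> real \<Rightarrow> real" and E :: "real \<Rightarrow> real \<Rightarrow> real"
  assumes "0 < L" and T: "0 \<le> T"
    and cont: "continuous_on ({0..} \<times> UNIV \<times> UNIV) (\<lambda>(t, x, v). f t x v)"
      "continuous_on ({0..} \<times> UNIV \<times> UNIV) (\<lambda>(t, x, v). ft t x v)"
      "continuous_on ({0..} \<times> UNIV \<times> UNIV) (\<lambda>(t, x, v). fx t x v)"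
      "continuous_on ({0..} \<times> UNIV \<times> UNIV) (\<lambda>(t, x, v). fv t x v)"
      "continuous_on ({0..} \<times> UNIV) (\<lambda>(t, x). E t x)"
    and ft: "\<And>t x v. 0 \<le> t \<Longrightarrow> ((\<lambda>s. f s x v) has_real_derivative ft t x v) (at t within {0..})"
    and fx: "\<And>t x v. 0 \<le> t \<Longrightarrow> ((\<lambda>y. f t y v) has_real_derivative fx t x v) (at x)"
    and fv: "\<And>t x v. 0 \<le> t \<Longrightarrow> ((\<lambda>w. f t x w) has_real_derivative fv t x v) (at v)"
    and eq: "\<And>t x v. 0 \<le> t \<Longrightarrow> ft t x v + v * fx t x v + E t x * fv t x v = 0"
    and per: "\<And>t v. 0 \<le> t \<Longrightarrow> f t L v = f t 0 v"
    and K: "0 \<le> K" "\<And>t x. 0 \<le> t \<Longrightarrow> x \<in> {0..L} \<Longrightarrow> \<bar>E t x\<bar> \<le> K"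
    and \<alpha>: "\<And>t. 0 \<le> t \<Longrightarrow> (\<alpha> has_real_derivative \<alpha>' t) (at t within {0..})" "continuous_on {0..} \<alpha>'"
    and c: "\<And>t x v. 0 \<le> t \<Longrightarrow> x \<in> {0..L} \<Longrightarrow> \<alpha> t * \<alpha>' t * v\<^sup>2 + E t x * (\<alpha> t)\<^sup>2 * v \<le> c"
  defines "Q \<equiv> \<lambda>t. \<integral>\<^sup>+(x, v). ennreal ((f t x v)\<^sup>2 * weight \<alpha> t v) \<partial>(torus_measure L \<Otimes>\<^sub>M lborel)"
  shows "Q T \<le> Q 0 * ennreal (exp (c * T))"
proof -
  let ?M = "torus_measure L \<Otimes>\<^sub>M (lborel :: real measure)"
  \<comment> \<open>The radii \<open>Suc n\<close> are positive and tend to infinity.\<close>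
  define g where "g n t z = (f t (fst z) (snd z))\<^sup>2 * (weight \<alpha> t (snd z) * (cutoff K (real (Suc n)) t (snd z))\<^sup>2)" for n t z
  have contg: "continuous_on UNIV (g n t)" if "0 \<le> t" for n t
    unfolding g_def[abs_def] weight_def cutoff_def using that
    by (intro continuous_intros continuous_on_time_compose3[OF cont(1)]) auto
  have g0: "0 \<le> g n t z" for n t z
    using weight_pos[of \<alpha> t "snd z"] by (simp add: g_def)
  have int: "(\<integral>\<^sup>+z. ennreal (g n t z) \<partial>?M) = ennreal (integral (cbox (0, - real (Suc n)) (L, real (Suc n))) (g n t))"
    if t: "0 \<le> t" for n t
  proof (rule nn_integral_torus_times_compact[OF contg[OF t] g0])
    fix x v :: real assume "real (Suc n) \<le> \<bar>v\<bar>"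
    then show "g n t (x, v) = 0" using cutoff_range(3)[OF _ K(1) t] by (simp add: g_def)
  qed
  have "(\<integral>\<^sup>+z. ennreal (g n T z) \<partial>?M) \<le> Q 0 * ennreal (exp (c * T))" for n
  proof -
    let ?B = "cbox (0, - real (Suc n)) (L, real (Suc n))"
    have J: "integral ?B (g n T) \<le> integral ?B (g n 0) * exp (c * T)"
      using cutoff_energy[OF \<open>0 < L\<close> _ T cont ft fx fv eq per K \<alpha> c, of "real (Suc n)"]
      by (simp add: g_def[abs_def] split_beta')
    have "0 \<le> integral ?B (g n 0)"
      using g0 by (intro integral_nonneg integrable_continuous continuous_on_subset[OF contg]) auto
    then have "(\<integral>\<^sup>+z. ennreal (g n T z) \<partial>?M) \<le> (\<integral>\<^sup>+z. ennreal (g n 0 z) \<partial>?M) * ennreal (exp (c * T))"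
      unfolding int[OF T] int[OF order_refl] using J by (simp add: ennreal_leI flip: ennreal_mult)
    also have "\<dots> \<le> Q 0 * ennreal (exp (c * T))"
      unfolding Q_def
    proof (intro mult_right_mono nn_integral_mono)
      fix z :: "real \<times> real"
      have "(cutoff K (real (Suc n)) 0 (snd z))\<^sup>2 \<le> 1"
        using cutoff_range(1,2)[OF _ K(1) order_refl, of "real (Suc n)" "snd z"] by (simp add: power_le_one)
      then have "weight \<alpha> 0 (snd z) * (cutoff K (real (Suc n)) 0 (snd z))\<^sup>2 \<le> weight \<alpha> 0 (snd z)"
        using weight_pos[of \<alpha> 0 "snd z"] by (simp add: mult_left_le)
      then show "ennreal (g n 0 z) \<le> (case z of (x, v) \<Rightarrow> ennreal ((f 0 x v)\<^sup>2 * weight \<alpha> 0 v))"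
        by (auto simp: g_def split_beta intro!: ennreal_leI mult_left_mono)
    qed simp
    finally show ?thesis .
  qed
  then have "liminf (\<lambda>n. \<integral>\<^sup>+z. ennreal (g n T z) \<partial>?M) \<le> liminf (\<lambda>n. Q 0 * ennreal (exp (c * T)))"
    by (intro Liminf_mono always_eventually allI)
  then have liminf: "liminf (\<lambda>n. \<integral>\<^sup>+z. ennreal (g n T z) \<partial>?M) \<le> Q 0 * ennreal (exp (c * T))"
    by (simp add: Liminf_const)
  have "Q T = (\<integral>\<^sup>+z. liminf (\<lambda>n. ennreal (g n T z)) \<partial>?M)"
    unfolding Q_def
  proof (rule nn_integral_cong)
    fix z :: "real \<times> real"
    have "(\<lambda>n. g n T z) \<longlonglongrightarrow> (f T (fst z) (snd z))\<^sup>2 * (weight \<alpha> T (snd z) * 1\<^sup>2)"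
      unfolding g_def by (intro tendsto_intros cutoff_tendsto)
    then have "(\<lambda>n. ennreal (g n T z)) \<longlonglongrightarrow> ennreal ((f T (fst z) (snd z))\<^sup>2 * (weight \<alpha> T (snd z) * 1\<^sup>2))"
      by (rule tendsto_ennrealI)
    then show "(case z of (x, v) \<Rightarrow> ennreal ((f T x v)\<^sup>2 * weight \<alpha> T v)) = liminf (\<lambda>n. ennreal (g n T z))"
      by (simp add: lim_imp_Liminf split_beta)
  qed
  also have "\<dots> \<le> liminf (\<lambda>n. \<integral>\<^sup>+z. ennreal (g n T z) \<partial>?M)"
    using borel_measurable_torus_times[OF contg[OF T]]
    by (intro nn_integral_liminf measurable_compose[OF _ measurable_ennreal])
  finally show ?thesis using liminf by (rule order_trans)
qed

section \<open>The growth rate and the final estimate\<close>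

text \<open>In terms of \<open>b = a\<^sup>2 * v\<close> the two summands are
  \<open>- \<gamma> * m * b\<^sup>2 / 2\<close> and \<open>E * b\<close>. Young's inequality bounds
  the second by \<open>1 / (2 * \<eta>)\<close> plus \<open>\<eta> * C * b\<^sup>2 / 2\<close>, and
  the first absorbs this quadratic term.\<close>

lemma weight_exponent_bound:
  fixes a E v :: real
  assumes "\<bar>E\<bar> \<le> sqrt C" "0 < C" "1 \<le> m" "0 < \<eta>" "\<eta> * C \<le> \<gamma>"
  shows "a * (- (\<gamma> / 2) * a ^ 3 * m) * v\<^sup>2 + E * a\<^sup>2 * v \<le> 1 / (2 * \<eta>)"
proof -
  define b where "b = a\<^sup>2 * v"
  have "0 \<le> (1 - \<eta> * sqrt C * \<bar>b\<bar>)\<^sup>2 / (2 * \<eta>)" using assms by simp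
  also have "\<dots> = 1 / (2 * \<eta>) - sqrt C * \<bar>b\<bar> + \<eta> * C * b\<^sup>2 / 2"
    using assms by (simp add: power2_diff power_mult_distrib field_simps) (simp add: power2_eq_square)
  finally have 1: "sqrt C * \<bar>b\<bar> \<le> 1 / (2 * \<eta>) + \<eta> * C * b\<^sup>2 / 2" by simp
  have "E * b \<le> \<bar>E\<bar> * \<bar>b\<bar>" by (metis abs_ge_self abs_mult)
  also have "\<dots> \<le> sqrt C * \<bar>b\<bar>" using assms by (intro mult_right_mono) auto
  finally have 2: "E * b \<le> sqrt C * \<bar>b\<bar>" .
  have "0 < \<gamma>" using assms by (meson less_le_trans mult_pos_pos)
  then have "\<eta> * C * b\<^sup>2 \<le> \<gamma> * m * b\<^sup>2"
    using assms mult_left_mono[of 1 m \<gamma>] by (intro mult_right_mono) (linarith, simp)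
  moreover have "a * (- (\<gamma> / 2) * a ^ 3 * m) * v\<^sup>2 = - (\<gamma> * m * b\<^sup>2 / 2)"
    by (simp add: b_def power2_eq_square power3_eq_cube)
  moreover have "E * a\<^sup>2 * v = E * b" by (simp add: b_def)
  ultimately show ?thesis using 1 2 by linarith
qed

theorem proposition2p2:
  fixes L \<alpha>0 \<gamma> \<nu>lo \<nu>hi \<eta> :: real
    and C :: "real \<Rightarrow> real"
    and Nx k N :: nat
    and xp :: "nat \<Rightarrow> real"
    and \<nu> :: "nat \<Rightarrow> real"
    and C\<delta> :: "nat \<Rightarrow> real \<Rightarrow> real \<Rightarrow> real"
    and f\<delta> f :: "real \<Rightarrow> real \<Rightarrow> real \<Rightarrow> real"
    and E\<delta> E :: "real \<Rightarrow> real \<Rightarrow> real"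
    and f0 :: "real \<Rightarrow> real \<Rightarrow> real"
    and \<alpha> :: "real \<Rightarrow> real"
  assumes "0 < L" and "0 < \<alpha>0" and "0 < \<gamma>"
    and "mesh L Nx xp" and "1 \<le> N"
    and "0 < \<nu>lo" and "\<nu>lo \<le> \<nu>hi" and "\<forall>n<N. \<nu> n \<in> {\<nu>lo..\<nu>hi}"
    and "\<forall>t\<ge>0. \<alpha> t = alpha_of L \<alpha>0 \<gamma> E\<delta> t"
    and "dg_hermite_solution L Nx xp k N \<nu> \<alpha> C\<delta> f\<delta> E\<delta>"
    and "vlasov_poisson_solution L f0 f E"
    and "in_L2 (mu L \<alpha> 0) f0"
    and "0 < C (mass L f0)"
    and "\<forall>t\<ge>0. (Linf_norm L (E t))\<^sup>2 \<le> ennreal (C (mass L f0))"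
    and "0 < \<eta>" and "\<eta> * C (mass L f0) / \<gamma> < 1"
  shows "\<forall>t\<ge>0. in_L2 (mu L \<alpha> t) (f t) \<and>
           L2_norm (mu L \<alpha> t) (f t) \<le> L2_norm (mu L \<alpha> 0) f0 * exp (t / (4 * \<eta>))"
proof (intro allI impI)
  fix T :: real assume T: "0 \<le> T"
  let ?C = "C (mass L f0)" and ?m = "\<lambda>t. max 1 ((enn2real (Linf_norm L (E\<delta> t)))\<^sup>2)"
  note L = \<open>0 < L\<close> and eta = \<open>0 < \<eta>\<close> and C = \<open>0 < ?C\<close>
  note vp = \<open>vlasov_poisson_solution L f0 f E\<close>[unfolded vlasov_poisson_solution_def Let_def]
  have cont_f: "C1_on ({0..} \<times> UNIV \<times> UNIV) (\<lambda>(t, x, v). f t x v)"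
    and "C1_on ({0..} \<times> UNIV) (\<lambda>(t, x). E t x)"
    and "\<forall>t\<ge>0. \<forall>v. periodic L (\<lambda>x. f t x v)" and "\<forall>x v. f 0 x v = f0 x v"
    using vp by - (elim conjE, assumption)+
  then have per: "\<And>t v. 0 \<le> t \<Longrightarrow> f t L v = f t 0 v" and init: "f 0 = f0"
    unfolding periodic_def by (metis add_0, blast)
  obtain ft fx fv where
    partial: "continuous_on ({0..} \<times> UNIV \<times> UNIV) (\<lambda>(t, x, v). ft t x v)"
      "continuous_on ({0..} \<times> UNIV \<times> UNIV) (\<lambda>(t, x, v). fx t x v)"
      "continuous_on ({0..} \<times> UNIV \<times> UNIV) (\<lambda>(t, x, v). fv t x v)"
    and deriv: "\<And>t x v. 0 \<le> t \<Longrightarrow> ((\<lambda>s. f s x v) has_real_derivative ft t x v) (at t within {0..})"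
      "\<And>t x v. 0 \<le> t \<Longrightarrow> ((\<lambda>y. f t y v) has_real_derivative fx t x v) (at x)"
      "\<And>t x v. 0 \<le> t \<Longrightarrow> ((\<lambda>w. f t x w) has_real_derivative fv t x v) (at v)"
    using C1_on_partial_derivatives3[OF cont_f] by blast
  have f: "continuous_on ({0..} \<times> UNIV \<times> UNIV) (\<lambda>(t, x, v). f t x v)"
    using cont_f C1_on_imp_continuous_on by blast
  have E: "continuous_on ({0..} \<times> UNIV) (\<lambda>(t, x). E t x)"
    using \<open>C1_on ({0..} \<times> UNIV) (\<lambda>(t, x). E t x)\<close> by (rule C1_on_imp_continuous_on)
  \<comment> \<open>The solution concept supplies its own derivatives at each point; uniqueness
    identifies them with the jointly continuous ones chosen above.\<close>
  have eq: "ft t x v + v * fx t x v + E t x * fv t x v = 0" if t: "0 \<le> t" for t x v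
  proof -
    have "\<forall>t\<ge>0. \<forall>x v. \<exists>ft fx fv.
        ((\<lambda>s. f s x v) has_real_derivative ft) (at t within {0..}) \<and>
        ((\<lambda>y. f t y v) has_real_derivative fx) (at x) \<and>
        ((\<lambda>w. f t x w) has_real_derivative fv) (at v) \<and>
        ft + v * fx + E t x * fv = 0"
      using vp by - (elim conjE, assumption)
    then obtain a b d where abd: "((\<lambda>s. f s x v) has_real_derivative a) (at t within {0..})"
        "((\<lambda>y. f t y v) has_real_derivative b) (at x)" "((\<lambda>w. f t x w) has_real_derivative d) (at v)"
        "a + v * b + E t x * d = 0"
      using t by blast
    then show ?thesis
      using has_real_derivative_unique_within_Ici[OF abd(1) deriv(1)[OF t] t]
        DERIV_unique[OF abd(2) deriv(2)[OF t]] DERIV_unique[OF abd(3) deriv(3)[OF t]] by simp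
  qed
  have E_bound: "\<bar>E t x\<bar> \<le> sqrt ?C" if t: "0 \<le> t" and x: "x \<in> {0..L}" for t x
  proof (rule Linf_norm_continuous_bound[OF _ L _ _ x])
    show "continuous_on UNIV (E t)"
      using continuous_on_time_compose2[OF E, of UNIV "\<lambda>_. t" "\<lambda>x. x"] t by simp
    show "Linf_norm L (E t) \<le> ennreal (sqrt ?C)"
      using assms(14) t C by (intro ennreal_power2_le_imp_le_sqrt) auto
  qed (use C in simp)
  have norm: "continuous_on {0..} (\<lambda>t. enn2real (Linf_norm L (E\<delta> t)))"
    using dg_field_norm_continuous[OF L assms(4,5,10)] .
  \<comment> \<open>The function \<alpha> agrees with \<open>alpha_of\<close> on nonnegative times,
    which suffices for a derivative within \<open>{0..}\<close>.\<close>
  have \<alpha>: "(\<alpha> has_real_derivative - (\<gamma> / 2) * \<alpha> t ^ 3 * ?m t) (at t within {0..})" if t: "0 \<le> t" for t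
  proof (rule has_field_derivative_transform_within[of _ _ _ _ 1])
    show "(alpha_of L \<alpha>0 \<gamma> E\<delta> has_real_derivative - (\<gamma> / 2) * \<alpha> t ^ 3 * ?m t) (at t within {0..})"
      using alpha_of_derivative[OF assms(2,3) norm t] assms(9) t by simp
  qed (use assms(9) t in auto)
  then have "continuous_on {0..} \<alpha>" by (intro DERIV_continuous_on) auto
  then have \<alpha>': "continuous_on {0..} (\<lambda>t. - (\<gamma> / 2) * \<alpha> t ^ 3 * ?m t)"
    by (intro continuous_intros norm)
  define Q where "Q t = (\<integral>\<^sup>+(x, v). ennreal ((f t x v)\<^sup>2 * weight \<alpha> t v) \<partial>(torus_measure L \<Otimes>\<^sub>M lborel))" for t
  have L2: "in_L2 (mu L \<alpha> t) (f t) \<longleftrightarrow> Q t < \<infinity>" "L2_norm (mu L \<alpha> t) (f t) = sqrt (enn2real (Q t))"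
    if "0 \<le> t" for t
  proof -
    have "continuous_on UNIV (\<lambda>(x, v). f t x v)"
      unfolding split_beta using that
      by (intro continuous_on_time_compose3[OF f] continuous_intros) auto
    then show "in_L2 (mu L \<alpha> t) (f t) \<longleftrightarrow> Q t < \<infinity>" "L2_norm (mu L \<alpha> t) (f t) = sqrt (enn2real (Q t))"
      unfolding Q_def by (rule L2_mu)+
  qed
  have "\<eta> * ?C \<le> \<gamma>" using assms(3,16) by simp
  \<comment> \<open>The drift of the cutoff is \<open>K = sqrt ?C\<close> and the growth rate of the
    squared norm is \<open>c = 1 / (2 * \<eta>)\<close>.\<close>
  then have "Q T \<le> Q 0 * ennreal (exp (1 / (2 * \<eta>) * T))"
    unfolding Q_def using C E_bound eta
    by (intro limit_weighted_energy[OF L T f partial E deriv eq per _ E_bound \<alpha> \<alpha>'] weight_exponent_bound) auto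
  moreover have fin: "Q 0 < \<infinity>" using assms(12) L2(1)[of 0] init by simp
  \<comment> \<open>Finiteness of \<open>Q 0\<close> makes the right-hand side finite; only then
    does \<open>enn2real\<close> preserve the inequality.\<close>
  ultimately have Q: "Q T < \<infinity>" "enn2real (Q T) \<le> enn2real (Q 0) * exp (1 / (2 * \<eta>) * T)"
    using enn2real_mono[of "Q T" "Q 0 * ennreal (exp (1 / (2 * \<eta>) * T))"]
    by (auto simp: ennreal_mult_less_top enn2real_mult intro: le_less_trans)
  \<comment> \<open>Taking the square root halves the rate for the squared norm to
    \<open>1 / (4 * \<eta>)\<close>.\<close>
  have "exp (1 / (2 * \<eta>) * T) = (exp (T / (4 * \<eta>)))\<^sup>2"
    by (simp flip: exp_double)
  then have "sqrt (enn2real (Q T)) \<le> sqrt (enn2real (Q 0)) * exp (T / (4 * \<eta>))"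
    using real_sqrt_le_mono[OF Q(2)] by (simp add: real_sqrt_mult)
  then show "in_L2 (mu L \<alpha> T) (f T) \<and>
      L2_norm (mu L \<alpha> T) (f T) \<le> L2_norm (mu L \<alpha> 0) f0 * exp (T / (4 * \<eta>))"
    using L2[OF T] L2(2)[of 0] init Q(1) by simp
qed

end
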